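(* For every nonzero ideal $\mathfrak n$ of $A$ generated by a monic polynomial $n$, \[T_{\mathfrak n}E(z,s)=|\mathfrak n|^s\,\sigma_{1-2s}(\mathfrak n)\,E(z,s).\]
   Context: $q$ odd prime power, $A=\mathbb{F}_q[T]$, $k_\infty=\mathbb{F}_q((T^{-1}))$, $|T|=q$, $\Omega=\mathbb{C}_\infty\smallsetminus k_\infty$, $\Gamma=\mathrm{PGL}_2(A)$, $\Gamma_\infty$ its upper-triangular subgroup. $|z|_i=\min_{w\in k_\infty}|z-w|$ and $E(z,s)=\sum_{\gamma\in\Gamma_\infty\backslash\Gamma}|\gamma z|_i^s$. The Hecke operator is $T_{\mathfrak n}F(z)=\sum_{a\text{ monic},\,ad=n,\,\deg b<\deg d}F\big(\frac{az+b}{d}\big)$ for $F$ on $\Gamma\backslash\Omega$; $|\mathfrak n|=q^{\deg n}$; and $\sigma_s(\mathfrak n)=\sigma_s(n)=\sum_{m\text{ monic},\,m\mid n}|m|^s$. *)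

theory Defs
  imports Complex_Main "HOL-Computational_Algebra.Polynomial"
    "HOL-Computational_Algebra.Formal_Laurent_Series"
    "HOL-Analysis.Infinite_Sum" "HOL-Analysis.Complex_Transcendental" "HOL-Library.Cardinality"
begin

text \<open>Conventions. The finite field F_q is a type 'f of class field and finite,
 q = CARD('f). A = 'f poly. k_infinity = F_q((T^-1)) is the Laurent series field 'f fls
 in the variable X = T^-1, so T corresponds to fls_X_inv. The field C_infinity is
 given abstractly as a field 'c with an embedding iota of k_infinity and an absolute
 value nv, subject to the axioms of C_infinity (see is_C_infty).\<close>

definition A_to_kinf :: "'f::field poly \<Rightarrow> 'f fls" where
  "A_to_kinf p = poly (map_poly fls_const p) fls_X_inv"

definition kinf_abs :: "'f::{field,finite} fls \<Rightarrow> real" where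
  "kinf_abs x = (if x = 0 then 0 else real CARD('f) powr (- real_of_int (fls_subdegree x)))"

definition alg_over :: "('k::field \<Rightarrow> 'c::field) \<Rightarrow> 'c \<Rightarrow> bool" where
  "alg_over \<iota> z \<longleftrightarrow> (\<exists>p :: 'k poly. p \<noteq> 0 \<and> poly (map_poly \<iota> p) z = 0)"

text \<open>(C, iota, nv) is (a model of) C_infinity: a complete, algebraically closed,
 non-archimedean valued field extension of k_infinity in which the algebraic closure
 of k_infinity is dense (i.e. the completion of an algebraic closure of k_infinity).\<close>
definition is_C_infty :: "('f::{field,finite} fls \<Rightarrow> 'c::field) \<Rightarrow> ('c \<Rightarrow> real) \<Rightarrow> bool" where
  "is_C_infty \<iota> nv \<longleftrightarrow>
     (\<forall>x y. \<iota> (x + y) = \<iota> x + \<iota> y) \<and> (\<forall>x y. \<iota> (x * y) = \<iota> x * \<iota> y) \<and> \<iota> 1 = 1 \<and>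
     (\<forall>x. nv x \<ge> 0) \<and> (\<forall>x. nv x = 0 \<longleftrightarrow> x = 0) \<and>
     (\<forall>x y. nv (x * y) = nv x * nv y) \<and>
     (\<forall>x y. nv (x + y) \<le> max (nv x) (nv y)) \<and>
     (\<forall>x. nv (\<iota> x) = kinf_abs x) \<and>
     (\<forall>u :: nat \<Rightarrow> 'c. (\<forall>e>0. \<exists>N. \<forall>m\<ge>N. \<forall>n\<ge>N. nv (u m - u n) < e)
          \<longrightarrow> (\<exists>l. \<forall>e>0. \<exists>N. \<forall>n\<ge>N. nv (u n - l) < e)) \<and>
     (\<forall>p :: 'c poly. degree p > 0 \<longrightarrow> (\<exists>z. poly p z = 0)) \<and>
     (\<forall>z e. e > 0 \<longrightarrow> (\<exists>y. alg_over \<iota> y \<and> nv (z - y) < e))"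

definition Omega :: "('f::{field,finite} fls \<Rightarrow> 'c::field) \<Rightarrow> 'c set" where
  "Omega \<iota> = UNIV - range \<iota>"

definition imag_abs :: "('f::{field,finite} fls \<Rightarrow> 'c::field) \<Rightarrow> ('c \<Rightarrow> real) \<Rightarrow> 'c \<Rightarrow> real" where
  "imag_abs \<iota> nv z = (INF w. nv (z - \<iota> w))"

text \<open>2x2 matrices over A as quadruples (a,b,c,d) = [[a,b],[c,d]].\<close>
type_synonym 'f mat2 = "'f poly \<times> 'f poly \<times> 'f poly \<times> 'f poly"

definition mat_mult :: "'f::field mat2 \<Rightarrow> 'f mat2 \<Rightarrow> 'f mat2" where
  "mat_mult M N = (case M of (a,b,c,d) \<Rightarrow> case N of (a',b',c',d') \<Rightarrow>
     (a*a' + b*c', a*b' + b*d', c*a' + d*c', c*b' + d*d'))"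

definition GL2A :: "'f::field mat2 set" where
  "GL2A = {(a,b,c,d). \<exists>u. u \<noteq> 0 \<and> a*d - b*c = [:u:]}"

definition GL2A_inf :: "'f::field mat2 set" where
  "GL2A_inf = {M \<in> GL2A. fst (snd (snd M)) = 0}"

text \<open>Right cosets Gamma_infinity gamma.  Since the scalar matrices lie in
 Gamma_infinity, these are in bijection with the cosets in PGL_2(A).\<close>
definition cosets_inf :: "'f::field mat2 set set" where
  "cosets_inf = {(\<lambda>h. mat_mult h g) ` GL2A_inf | g. g \<in> GL2A}"

definition mob :: "('f::field fls \<Rightarrow> 'c::field) \<Rightarrow> 'f mat2 \<Rightarrow> 'c \<Rightarrow> 'c" where
  "mob \<iota> M z = (case M of (a,b,c,d) \<Rightarrow>
     (\<iota> (A_to_kinf a) * z + \<iota> (A_to_kinf b)) / (\<iota> (A_to_kinf c) * z + \<iota> (A_to_kinf d)))"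

text \<open>Eisenstein series E(z,s) = sum over Gamma_infinity\Gamma of |gamma z|_i^s
 (the summand is independent of the coset representative).\<close>
definition Eis :: "('f::{field,finite} fls \<Rightarrow> 'c::field) \<Rightarrow> ('c \<Rightarrow> real) \<Rightarrow> 'c \<Rightarrow> complex \<Rightarrow> complex" where
  "Eis \<iota> nv z s = (\<Sum>\<^sub>\<infinity>C\<in>(cosets_inf :: 'f mat2 set set).
      complex_of_real (imag_abs \<iota> nv (mob \<iota> (SOME g. g \<in> C) z)) powr s)"

text \<open>Hecke operator.  The condition deg b < deg d (with deg 0 = -infinity) is
 rendered as b = 0 or degree b < degree d.\<close>
definition hecke :: "('f::{field,finite} fls \<Rightarrow> 'c::field) \<Rightarrow> 'f poly \<Rightarrow> ('c \<Rightarrow> complex) \<Rightarrow> 'c \<Rightarrow> complex" where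
  "hecke \<iota> n F z = (\<Sum>(a,b,d) \<in> {(a,b,d). lead_coeff a = 1 \<and> a * d = n \<and> (b = 0 \<or> degree b < degree d)}.
      F (mob \<iota> (a,b,0,d) z))"

definition ideal_norm :: "'f::{field,finite} poly \<Rightarrow> real" where
  "ideal_norm m = real CARD('f) ^ degree m"

definition sigma_div :: "complex \<Rightarrow> 'f::{field,finite} poly \<Rightarrow> complex" where
  "sigma_div s n = (\<Sum>m \<in> {m. lead_coeff m = 1 \<and> m dvd n}. complex_of_real (ideal_norm m) powr s)"

end

theory Submission
  imports Defs
begin

text \<open>Let \<open>G(z) = \<Sum>|x z + y|\<close> to the power \<open>-2s\<close>, over all nonzero \<open>(x, y) \<in> A\<^sup>2\<close>. Splitting off the
  content of \<open>(x, y)\<close> and using \<open>|\<gamma> z|\<^sub>i = |z|\<^sub>i / |c z + d|\<^sup>2\<close> gives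
  \<open>Z E(z,s) = |z|\<^sub>i\<^sup>s G(z)\<close>, where the factor \<open>Z\<close>, the sum of \<open>|m|\<close> to the power \<open>-2s\<close> over nonzero
  \<open>m \<in> A\<close>, does not vanish. The Hecke operator turns \<open>G\<close> into a sum over the sublattices of
  \<open>A\<^sup>2\<close> of index \<open>n\<close>, in which a vector \<open>v\<close> occurs as often as there are such sublattices
  containing it. That number is the sum of \<open>|g|\<close> over the monic \<open>g\<close> dividing \<open>n\<close> and \<open>v\<close>;
  substituting \<open>v = g w\<close> produces \<open>\<sigma>\<close> at \<open>1 - 2s\<close>. All series converge absolutely when
  \<open>|z|\<^sub>i > 0\<close>. If \<open>|z|\<^sub>i = 0\<close> every term of every \<open>E\<close> is zero (\<open>0 powr s = 0\<close>), so that it need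
  not be shown that \<open>k\<^sub>\<infinity>\<close> is closed.\<close>

section \<open>Counting sublattices of \<open>A\<^sup>2\<close>\<close>

text \<open>Euclid's algorithm: a Bezout identity for \<open>(y, x mod y)\<close> becomes one for
  \<open>(x, y)\<close>. The cofactors are part of the conclusion because for nonzero
  \<open>g\<close> the pair \<open>(x', y')\<close> is a primitive vector.\<close>

lemma poly_bezout:
  fixes x y :: "'a::field poly"
  obtains g p r x' y' where "g = p * x + r * y" "x = g * x'" "y = g * y'"
proof -
  have "\<exists>g p r x' y'. g = p * x + r * y \<and> x = g * x' \<and> y = g * y'"
  proof (induction "euclidean_size y" arbitrary: x y rule: less_induct)
    case less
    show ?case
    proof (cases "y = 0")
      case True
      then have "x = 1 * x + 0 * y \<and> x = x * 1 \<and> y = x * 0" by simp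
      then show ?thesis by blast
    next
      case False
      then have "euclidean_size (x mod y) < euclidean_size y"
        by (rule mod_size_less)
      from less[OF this] obtain g p r x' y'
        where *: "g = p * y + r * (x mod y)" "y = g * x'" "x mod y = g * y'" by blast
      have x: "x = (x div y) * y + x mod y" by simp
      have "g = r * x + (p - r * (x div y)) * y"
        using *(1) by (simp add: algebra_simps minus_div_mult_eq_mod [symmetric])
      moreover have "x = g * (x div y * x' + y')"
        using x *(2,3) by (metis distrib_left mult.left_commute)
      ultimately show ?thesis using *(2) by blast
    qed
  qed
  then show ?thesis using that by blast
qed

text \<open>Zero belongs to the set for every \<open>k\<close>, also for \<open>k = 0\<close>, as
  the convention deg 0 = -infinity demands. For nonzero \<open>d\<close> over a field,
  \<open>polys_below (degree d)\<close> is a complete system of residues modulo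
  \<open>d\<close>.\<close>

definition polys_below :: "nat \<Rightarrow> 'a::zero poly set" where
  "polys_below k = {p. p = 0 \<or> degree p < k}"

lemma polys_below_0 [simp]: "polys_below 0 = {0}"
  by (auto simp: polys_below_def)

text \<open>Splitting off the constant coefficient gives a recursion in the degree bound, from which
  finiteness, cardinality and the bound for the zeta sums are all derived.\<close>

lemma polys_below_Suc:
  "polys_below (Suc k) = (\<lambda>(c, p). pCons c p) ` (UNIV \<times> polys_below k)"
proof (intro equalityI subsetI)
  fix p :: "'a poly" assume p: "p \<in> polys_below (Suc k)"
  obtain c r where [simp]: "p = pCons c r" by (cases p)
  have "r \<in> polys_below k"
    using p by (auto simp: polys_below_def split: if_splits)
  then show "p \<in> (\<lambda>(c, p). pCons c p) ` (UNIV \<times> polys_below k)" by auto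
next
  fix p :: "'a poly" assume "p \<in> (\<lambda>(c, p). pCons c p) ` (UNIV \<times> polys_below k)"
  then obtain c r where "p = pCons c r" "r \<in> polys_below k" by auto
  then show "p \<in> polys_below (Suc k)"
    by (cases "r = 0") (auto simp: polys_below_def)
qed

lemma inj_pCons: "inj_on (\<lambda>(c, p). pCons c p) A"
  by (auto simp: inj_on_def)

lemma finite_polys_below [simp]: "finite (polys_below k :: 'a::{zero,finite} poly set)"
  by (induction k) (auto simp: polys_below_Suc)

lemma card_polys_below: "card (polys_below k :: 'a::{zero,finite} poly set) = CARD('a) ^ k"
  by (induction k) (simp_all add: polys_below_Suc card_image[OF inj_pCons] card_cartesian_product)

lemma finite_monic_divisors:
  fixes n :: "'a::{field,finite} poly"
  assumes "n \<noteq> 0"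
  shows "finite {m. lead_coeff m = 1 \<and> m dvd n}"
proof (rule finite_subset)
  show "{m. lead_coeff m = 1 \<and> m dvd n} \<subseteq> polys_below (Suc (degree n))"
    using dvd_imp_degree_le[OF _ assms] by (auto simp: polys_below_def less_Suc_eq_le)
qed simp

lemma polys_below_add:
  assumes "p \<in> polys_below k" "r \<in> polys_below k"
  shows "p + r \<in> polys_below k"
  using assms degree_add_less[of p k r] by (auto simp: polys_below_def)

lemma polys_below_diff:
  fixes p :: "'a::ab_group_add poly"
  assumes "p \<in> polys_below k" "r \<in> polys_below k"
  shows "p - r \<in> polys_below k"
  using polys_below_add[of p k "-r"] assms by (auto simp: polys_below_def)

lemma mod_in_polys_below: "d \<noteq> 0 \<Longrightarrow> p mod d \<in> polys_below (degree d)"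
  using degree_mod_less[of d p] by (auto simp: polys_below_def)

lemma polys_below_mult_iff:
  fixes d :: "'a::field poly"
  assumes "d \<noteq> 0" "g \<noteq> 0"
  shows "d * t \<in> polys_below (degree (g * d)) \<longleftrightarrow> t \<in> polys_below (degree g)"
  using assms by (cases "t = 0") (auto simp: polys_below_def degree_mult_eq)

text \<open>If \<open>g\<close> divides \<open>y\<close>, division by \<open>g\<close> leaves a
  congruence modulo \<open>d'\<close> whose coefficient \<open>c'\<close> is invertible, so
  \<open>b\<close> is confined to one residue class modulo \<open>d'\<close>. As
  \<open>degree d = degree g + degree d'\<close>, this class has as many members below
  \<open>degree d\<close> as there are polynomials below \<open>degree g\<close>.\<close>

lemma card_linear_congruence:
  fixes c d y :: "'a::{field,finite} poly"
  assumes "d \<noteq> 0" and g: "g = p * c + r * d" "g dvd c" "g dvd d"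
  shows "card {b \<in> polys_below (degree d). d dvd y - c * b} =
           (if g dvd y then CARD('a) ^ degree g else 0)"
proof (cases "g dvd y")
  case False
  have "\<not> d dvd y - c * b" for b
  proof
    assume "d dvd y - c * b"
    then have "g dvd (y - c * b) + c * b"
      using g by (meson dvd_add dvd_mult2 dvd_trans)
    with False show False by simp
  qed
  then show ?thesis using False by simp
next
  case True
  from g True obtain c' d' y' where cd: "c = g * c'" "d = g * d'" "y = g * y'"
    unfolding dvd_def by blast
  have nz: "g \<noteq> 0" "d' \<noteq> 0" using assms(1) cd by auto
  have "g * (p * c' + r * d') = g * 1"
    using g(1) unfolding cd by (simp add: algebra_simps)
  then have bez: "p * c' + r * d' = 1" using nz by (subst (asm) mult_cancel_left) auto
  \<comment> \<open>By \<open>bez\<close>, \<open>p\<close> inverts \<open>c'\<close> modulo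
    \<open>d'\<close>, so \<open>p * y'\<close> solves the reduced congruence; \<open>b0\<close> is
    its reduced representative.\<close>
  define b0 where "b0 = (p * y') mod d'"
  have b0: "d' dvd p * y' - b0" unfolding b0_def by (simp add: dvd_minus_mod)
  have b0d: "b0 \<in> polys_below (degree d)"
    using mod_in_polys_below[OF nz(2), of "p * y'"] nz cd
    unfolding b0_def polys_below_def by (auto simp: degree_mult_eq)
  have iff: "d dvd y - c * b \<longleftrightarrow> d' dvd b - b0" for b
  proof -
    have "d dvd y - c * b \<longleftrightarrow> d' dvd y' - c' * b"
      using nz unfolding cd by (metis dvd_mult_cancel_left mult.assoc right_diff_distrib)
    also have "\<dots> \<longleftrightarrow> d' dvd p * y' - b"
    proof
      assume "d' dvd y' - c' * b"
      then have "d' dvd p * (y' - c' * b) - d' * (r * b)" by (simp add: dvd_diff)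
      also have "p * (y' - c' * b) - d' * (r * b) = p * y' - (p * c' + r * d') * b"
        by (simp add: algebra_simps)
      finally show "d' dvd p * y' - b" using bez by simp
    next
      assume "d' dvd p * y' - b"
      then have "d' dvd c' * (p * y' - b) + d' * (r * y')" by (simp add: dvd_add)
      also have "c' * (p * y' - b) + d' * (r * y') = (p * c' + r * d') * y' - c' * b"
        by (simp add: algebra_simps)
      finally show "d' dvd y' - c' * b" using bez by simp
    qed
    also have "\<dots> \<longleftrightarrow> d' dvd b - b0"
    proof -
      have "b - b0 = (p * y' - b0) - (p * y' - b)" "p * y' - b = (p * y' - b0) - (b - b0)"
        by simp_all
      then show ?thesis using b0 dvd_diff by metis
    qed
    finally show ?thesis .
  qed
  have "{b \<in> polys_below (degree d). d dvd y - c * b} =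
          (\<lambda>t. b0 + d' * t) ` polys_below (degree g)" (is "?L = ?R")
  proof (intro equalityI subsetI)
    fix b assume b: "b \<in> ?L"
    then obtain t where t: "b - b0 = d' * t" by (auto simp: iff elim: dvdE)
    have "b - b0 \<in> polys_below (degree d)" using b b0d polys_below_diff by blast
    then have "t \<in> polys_below (degree g)"
      using polys_below_mult_iff[OF nz(2,1)] t cd by simp
    moreover have "b = b0 + d' * t" using t by (simp add: algebra_simps)
    ultimately show "b \<in> ?R" by blast
  next
    fix b assume "b \<in> ?R"
    then obtain t where t: "t \<in> polys_below (degree g)" "b = b0 + d' * t" by blast
    then have "d' * t \<in> polys_below (degree d)"
      using polys_below_mult_iff[OF nz(2,1)] cd by simp
    then show "b \<in> ?L" using t b0d polys_below_add by (auto simp: iff)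
  qed
  moreover have "inj_on (\<lambda>t. b0 + d' * t) (polys_below (degree g))"
    using nz by (auto simp: inj_on_def)
  ultimately show ?thesis
    using True by (simp add: card_image card_polys_below)
qed

section \<open>Hermite normal forms of determinant \<open>n\<close>\<close>

lemma lead_coeff_mult_eq_1:
  fixes a b :: "'a::field poly"
  assumes "lead_coeff a = 1" "lead_coeff (a * b) = 1"
  shows "lead_coeff b = 1"
  using assms by (simp add: lead_coeff_mult)

text \<open>Copies the index set in \<open>hecke\<close>, so that it can be folded there. A triple
  stands for the matrix with rows \<open>(a, b)\<close> and \<open>(0, d)\<close>.\<close>

definition hecke_matrices :: "'a::field poly \<Rightarrow> ('a poly \<times> 'a poly \<times> 'a poly) set" where
  "hecke_matrices n = {(a, b, d). lead_coeff a = 1 \<and> a * d = n \<and> (b = 0 \<or> degree b < degree d)}"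

lemma hecke_matrices_eq_image:
  assumes "n \<noteq> 0"
  shows "hecke_matrices n = (\<lambda>(a, b). (a, b, n div a)) `
    (SIGMA a:{a. lead_coeff a = 1 \<and> a dvd n}. polys_below (degree (n div a)))"
proof -
  have "a \<noteq> 0" if "lead_coeff a = 1" for a :: "'a poly" using that by auto
  then show ?thesis
    by (force simp: hecke_matrices_def polys_below_def)
qed

lemma finite_hecke_matrices:
  fixes n :: "'a::{field,finite} poly"
  assumes "n \<noteq> 0"
  shows "finite (hecke_matrices n)"
  unfolding hecke_matrices_eq_image[OF assms] using finite_monic_divisors[OF assms] by auto

text \<open>The number of sublattices of index \<open>n\<close> in \<open>A\<^sup>2\<close> containing \<open>(x, y)\<close>, a sublattice being
  recorded by its Hermite normal form \<open>(a, b; 0, d)\<close>.\<close>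

lemma card_hecke_matrices_containing:
  fixes n x y :: "'a::{field,finite} poly"
  assumes n: "lead_coeff n = 1"
  shows "card {(a, b, d) \<in> hecke_matrices n. \<exists>c e. x = c * a \<and> y = c * b + e * d} =
    (\<Sum>g | lead_coeff g = 1 \<and> g dvd n \<and> g dvd x \<and> g dvd y. CARD('a) ^ degree g)"
proof -
  have n0: "n \<noteq> 0" using n by auto
  obtain h0 p0 r0 where h0: "h0 = p0 * x + r0 * n" "h0 dvd x" "h0 dvd n"
    using poly_bezout[of x n] by (metis dvd_triv_left)
  have h0nz: "h0 \<noteq> 0" using h0 n0 by auto
  \<comment> \<open>Scaling by \<open>u\<close> makes the greatest common divisor \<open>h\<close>
    of \<open>x\<close> and \<open>n\<close> monic, so that \<open>D\<close> consists of the monic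
    common divisors of \<open>x\<close> and \<open>n\<close>.\<close>
  define u where "u = inverse (lead_coeff h0)"
  have u: "u \<noteq> 0" using h0nz by (simp add: u_def)
  define h where "h = smult u h0"
  have h: "lead_coeff h = 1" "h \<noteq> 0" using h0nz by (simp_all add: h_def u_def)
  have hb: "h = smult u p0 * x + smult u r0 * n" using h0 by (simp add: h_def smult_add_right)
  have hd: "h dvd x" "h dvd n" using h0 u by (auto simp: h_def smult_dvd)
  have div_h: "a dvd h \<longleftrightarrow> a dvd n \<and> a dvd x" for a
    using hb hd by (metis dvd_add dvd_mult dvd_trans)
  define D where "D = {a. lead_coeff a = 1 \<and> a dvd h}"
  have finD: "finite D" unfolding D_def using h(2) by (rule finite_monic_divisors)
  \<comment> \<open>Once \<open>a\<close> is fixed, \<open>d = n div a\<close> and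
    \<open>c = x div a\<close> are forced; what remains is a linear congruence for \<open>b\<close>
    modulo \<open>d\<close>.\<close>
  define B where "B a = {b \<in> polys_below (degree (n div a)). (n div a) dvd y - (x div a) * b}" for a
  have a0: "a \<noteq> 0" if "a \<in> D" for a using that by (auto simp: D_def)
  have "{(a, b, d) \<in> hecke_matrices n. \<exists>c e. x = c * a \<and> y = c * b + e * d} =
      (\<lambda>(a, b). (a, b, n div a)) ` Sigma D B" (is "?L = ?R")
  proof (intro equalityI subsetI)
    fix v assume "v \<in> ?L"
    then obtain a b d c e where v: "v = (a, b, d)" "lead_coeff a = 1" "a * d = n"
      "b = 0 \<or> degree b < degree d" "x = c * a" "y = c * b + e * d"
      unfolding hecke_matrices_def by blast
    have "a \<noteq> 0" using v by auto
    then have "n div a = d" "x div a = c" using v by auto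
    then have "(a, b) \<in> Sigma D B"
      using v dvd_triv_left[of a d] by (auto simp: D_def B_def div_h polys_below_def)
    then show "v \<in> ?R" using v \<open>n div a = d\<close> by force
  next
    fix v assume "v \<in> ?R"
    then obtain a b where v: "v = (a, b, n div a)" "a \<in> D" "b \<in> B a" by auto
    obtain e where "y - (x div a) * b = (n div a) * e" using v by (auto simp: B_def elim: dvdE)
    then have "y = (x div a) * b + e * (n div a)" by (simp add: algebra_simps)
    moreover have "x = (x div a) * a" using v by (auto simp: D_def div_h)
    ultimately show "v \<in> ?L"
      using v by (auto simp: D_def B_def hecke_matrices_def div_h polys_below_def)
  qed
  moreover have "inj_on (\<lambda>(a, b). (a, b, n div a)) (Sigma D B)" by (auto simp: inj_on_def)
  ultimately have "card {(a, b, d) \<in> hecke_matrices n. \<exists>c e. x = c * a \<and> y = c * b + e * d} =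
      card (Sigma D B)" by (simp add: card_image)
  also have "\<dots> = (\<Sum>a\<in>D. card (B a))"
    using finD by (intro card_SigmaI) (auto simp: B_def)
  also have "\<dots> = (\<Sum>a\<in>D. if (h div a) dvd y then CARD('a) ^ degree (h div a) else 0)"
  proof (rule sum.cong)
    fix a assume a: "a \<in> D"
    note nz = a0[OF a]
    from a have dv: "a dvd h" "a dvd n" "a dvd x" by (auto simp: D_def div_h)
    then obtain h' n' x' where e: "h = a * h'" "n = a * n'" "x = a * x'" by (auto elim!: dvdE)
    \<comment> \<open>Dividing the Bezout identity for \<open>h\<close> by \<open>a\<close> shows
      that \<open>h div a\<close> is a greatest common divisor of \<open>x div a\<close> and
      \<open>n div a\<close>, as the congruence count requires.\<close>
    have "a * h' = a * (smult u p0 * x' + smult u r0 * n')"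
      using hb unfolding e by (simp add: algebra_simps)
    then have "h' = smult u p0 * x' + smult u r0 * n'" using nz by (metis mult_cancel_left)
    moreover have "h' dvd x'" "h' dvd n'" using hd nz unfolding e by auto
    moreover have "n' \<noteq> 0" using n0 e by auto
    ultimately show "card (B a) = (if (h div a) dvd y then CARD('a) ^ degree (h div a) else 0)"
      unfolding B_def using nz card_linear_congruence[of n' h' "smult u p0" x' "smult u r0" y]
      by (simp add: e)
  qed simp
  also have "\<dots> = (\<Sum>g\<in>D. if g dvd y then CARD('a) ^ degree g else 0)"
  proof -
    \<comment> \<open>Passing to the complementary divisor is an involution of \<open>D\<close>; it
      turns \<open>h div a\<close> into the summation variable.\<close>
    have "h div a \<in> D \<and> h div (h div a) = a" if a: "a \<in> D" for a
    proof -
      obtain h' where e: "h = a * h'" using a by (auto simp: D_def elim!: dvdE)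
      then have "h' \<noteq> 0" using h by auto
      then show ?thesis
        using a a0[OF a] h(1) lead_coeff_mult_eq_1[of a h'] by (auto simp: D_def e)
    qed
    then show ?thesis
      by (intro sum.reindex_bij_witness[where i = "\<lambda>g. h div g" and j = "\<lambda>g. h div g"]) auto
  qed
  also have "\<dots> = (\<Sum>g | g \<in> D \<and> g dvd y. CARD('a) ^ degree g)"
    using finD by (simp add: sum.inter_filter)
  also have "{g. g \<in> D \<and> g dvd y} = {g. lead_coeff g = 1 \<and> g dvd n \<and> g dvd x \<and> g dvd y}"
    by (auto simp: D_def div_h)
  finally show ?thesis .
qed

section \<open>The zeta function of \<open>A\<close>\<close>

lemma ideal_norm_ge_1: "ideal_norm p \<ge> 1"
  by (simp add: ideal_norm_def)

lemma ideal_norm_pos: "ideal_norm p > 0"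
  by (simp add: ideal_norm_def)

lemma ideal_norm_pCons:
  "ideal_norm (pCons c p) = (if p = 0 then 1 else real CARD('f) * ideal_norm p)"
  for p :: "'f::{field,finite} poly"
  by (simp add: ideal_norm_def)

lemma ideal_norm_mult:
  fixes p r :: "'f::{field,finite} poly"
  shows "p \<noteq> 0 \<Longrightarrow> r \<noteq> 0 \<Longrightarrow> ideal_norm (p * r) = ideal_norm p * ideal_norm r"
  by (simp add: ideal_norm_def degree_mult_eq power_add)

lemma card_field_ge_2: "real CARD('f::{field,finite}) \<ge> 2"
proof -
  have "card {0, 1::'f} \<le> CARD('f)" by (intro card_mono) auto
  then show ?thesis by simp
qed

text \<open>The partial sums satisfy \<open>S (k + 1) \<le> q + r * S k\<close> with
  \<open>r < 1\<close>, and the bound is the fixed point \<open>q / (1 - r)\<close> of this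
  recursion. The zero polynomial contributes 1, since \<open>ideal_norm 0 = 1\<close>.\<close>

lemma sum_polys_below_ideal_norm_le:
  fixes \<sigma> :: real
  assumes "\<sigma> > 1"
  defines "r \<equiv> real CARD('f) powr (1 - \<sigma>)"
  shows "(\<Sum>p\<in>polys_below k. ideal_norm (p :: 'f::{field,finite} poly) powr (- \<sigma>)) \<le>
           real CARD('f) / (1 - r)"
proof -
  let ?q = "real CARD('f)"
  have q: "?q \<ge> 2" by (rule card_field_ge_2)
  have r: "0 < r" "r < 1"
    using q assms powr_less_mono[of "1 - \<sigma>" 0 ?q] by (auto simp: r_def)
  show ?thesis
  proof (induction k)
    case 0
    have "1 * (1 - r) \<le> ?q" using r q by simp
    then show ?case using r by (simp add: ideal_norm_def pos_le_divide_eq)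
  next
    case (Suc k)
    have "(\<Sum>p\<in>polys_below (Suc k). ideal_norm (p :: 'f poly) powr (- \<sigma>)) =
        (\<Sum>(c::'f, p)\<in>UNIV \<times> polys_below k. ideal_norm (pCons c p) powr (- \<sigma>))"
      unfolding polys_below_Suc
      by (subst sum.reindex[OF inj_pCons]) (simp add: case_prod_unfold)
    also have "\<dots> = ?q * (\<Sum>p\<in>polys_below k. ideal_norm (pCons (0::'f) p) powr (- \<sigma>))"
      by (simp add: sum.cartesian_product [symmetric] ideal_norm_pCons)
    also have "(\<Sum>p\<in>polys_below k. ideal_norm (pCons (0::'f) p) powr (- \<sigma>)) \<le>
        1 + (\<Sum>p\<in>polys_below k. ?q powr (- \<sigma>) * ideal_norm (p :: 'f poly) powr (- \<sigma>))"
    proof -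
      have z: "(0 :: 'f poly) \<in> polys_below k" by (simp add: polys_below_def)
      have "(\<Sum>p\<in>polys_below k. ideal_norm (pCons (0::'f) p) powr (- \<sigma>)) =
         1 + (\<Sum>p\<in>polys_below k - {0}. ideal_norm (pCons (0::'f) p) powr (- \<sigma>))"
        using z by (simp add: sum.remove[of _ 0] ideal_norm_pCons)
      also have "(\<Sum>p\<in>polys_below k - {0}. ideal_norm (pCons (0::'f) p) powr (- \<sigma>)) =
         (\<Sum>p\<in>polys_below k - {0}. ?q powr (- \<sigma>) * ideal_norm (p :: 'f poly) powr (- \<sigma>))"
        using ideal_norm_pos by (intro sum.cong) (auto simp: ideal_norm_pCons powr_mult less_imp_le)
      also have "\<dots> \<le> (\<Sum>p\<in>polys_below k. ?q powr (- \<sigma>) * ideal_norm (p :: 'f poly) powr (- \<sigma>))"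
        by (intro sum_mono2) auto
      finally show ?thesis by simp
    qed
    also have "?q * (1 + (\<Sum>p\<in>polys_below k. ?q powr (- \<sigma>) * ideal_norm (p :: 'f poly) powr (- \<sigma>))) =
        ?q + (?q * ?q powr (- \<sigma>)) * (\<Sum>p\<in>polys_below k. ideal_norm (p :: 'f poly) powr (- \<sigma>))"
      by (simp add: sum_distrib_left algebra_simps)
    also have "?q * ?q powr (- \<sigma>) = r"
      using q by (simp add: r_def powr_diff powr_minus divide_simps)
    also have "?q + r * (\<Sum>p\<in>polys_below k. ideal_norm (p :: 'f poly) powr (- \<sigma>)) \<le>
        ?q + r * (?q / (1 - r))"
      using Suc r by (intro add_left_mono mult_left_mono) auto
    also have "\<dots> = ?q / (1 - r)" using r by (simp add: field_simps)
    finally show ?case using q by simp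
  qed
qed

text \<open>Every finite set of polynomials lies in some \<open>polys_below k\<close>, and the bound
  on the sums over these sets does not depend on \<open>k\<close>.\<close>

lemma summable_ideal_norm:
  fixes \<sigma> :: real
  assumes "\<sigma> > 1"
  shows "(\<lambda>p :: 'f::{field,finite} poly. ideal_norm p powr (- \<sigma>)) summable_on UNIV"
proof (rule nonneg_bdd_above_summable_on)
  show "bdd_above (sum (\<lambda>p :: 'f poly. ideal_norm p powr (- \<sigma>)) ` {F. F \<subseteq> UNIV \<and> finite F})"
  proof (rule bdd_aboveI2)
    fix F :: "'f poly set" assume "F \<in> {F. F \<subseteq> UNIV \<and> finite F}"
    then have F: "finite F" by simp
    have "F \<subseteq> polys_below (Suc (Max (degree ` F)))"
      using F by (auto simp: polys_below_def less_Suc_eq_le)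
    from sum_mono2[OF finite_polys_below this, of "\<lambda>p. ideal_norm p powr (- \<sigma>)"]
    have "(\<Sum>p\<in>F. ideal_norm p powr (- \<sigma>)) \<le>
        (\<Sum>p\<in>polys_below (Suc (Max (degree ` F))). ideal_norm (p :: 'f poly) powr (- \<sigma>))"
      by simp
    also have "\<dots> \<le> real CARD('f) / (1 - real CARD('f) powr (1 - \<sigma>))"
      using assms by (rule sum_polys_below_ideal_norm_le)
    finally show "(\<Sum>p\<in>F. ideal_norm p powr (- \<sigma>)) \<le>
        real CARD('f) / (1 - real CARD('f) powr (1 - \<sigma>))" .
  qed
qed auto

lemma norm_of_real_powr:
  "x > 0 \<Longrightarrow> norm (complex_of_real x powr w) = x powr Re w"
  by (simp add: norm_powr_real_powr)

lemma summable_ideal_norm_complex: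
  fixes w :: complex
  assumes "Re w > 1"
  shows "(\<lambda>p :: 'f::{field,finite} poly. complex_of_real (ideal_norm p) powr (- w)) summable_on X"
proof -
  have "(\<lambda>p :: 'f poly. complex_of_real (ideal_norm p) powr (- w)) abs_summable_on UNIV"
    using summable_ideal_norm[OF assms, where 'f = 'f] by (simp add: norm_of_real_powr ideal_norm_pos)
  then show ?thesis
    by (rule summable_on_subset_banach[OF abs_summable_summable]) simp
qed

text \<open>All nonzero polynomials are summed, not only the monic ones, so for
  \<open>Re w > 1\<close> this is \<open>q - 1\<close> times the usual zeta function of
  \<open>A\<close>. The first argument only fixes the type \<open>'f\<close>.\<close>

definition zeta_A :: "'f::{field,finite} itself \<Rightarrow> complex \<Rightarrow> complex" where
  "zeta_A _ w = (\<Sum>\<^sub>\<infinity>p\<in>- {0 :: 'f poly}. complex_of_real (ideal_norm p) powr (- w))"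

text \<open>Nonzero constants contribute \<open>q - 1\<close>, and the polynomials
  \<open>c + T p\<close> with nonzero \<open>p\<close> contribute a multiple of the whole sum. If
  the sum were zero, this would give \<open>q - 1 = 0\<close>.\<close>

lemma zeta_A_nonzero:
  assumes "Re w > 1"
  shows "zeta_A TYPE('f::{field,finite}) w \<noteq> 0"
proof
  let ?f = "\<lambda>p :: 'f poly. complex_of_real (ideal_norm p) powr (- w)"
  let ?q = "complex_of_real (real CARD('f))"
  note summ = summable_ideal_norm_complex[OF assms, where 'f = 'f]
  assume zero: "zeta_A TYPE('f) w = 0"
  define X where "X = (\<lambda>c::'f. [:c:]) ` (- {0})"
  define Y where "Y = (\<lambda>(c::'f, p). pCons c p) ` (UNIV \<times> - {0})"
  have "- {0} = X \<union> Y"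
  proof (intro equalityI subsetI)
    fix p :: "'f poly" assume "p \<in> - {0}"
    then show "p \<in> X \<union> Y" by (cases p) (auto simp: X_def Y_def)
  qed (auto simp: X_def Y_def)
  moreover have "X \<inter> Y = {}" by (auto simp: X_def Y_def)
  ultimately have "0 = infsum ?f X + infsum ?f Y"
    using zero infsum_Un_disjoint[OF summ summ, of X Y] by (simp add: zeta_A_def)
  also have "infsum ?f X = of_nat (card (- {0::'f}))"
    unfolding X_def by (subst infsum_reindex) (auto simp: inj_on_def o_def ideal_norm_def)
  also have "infsum ?f Y = infsum (\<lambda>(c::'f, p). ?f (pCons c p)) (UNIV \<times> - {0})"
    unfolding Y_def by (subst infsum_reindex[OF inj_pCons]) (simp add: o_def case_prod_unfold)
  also have "\<dots> = infsum (\<lambda>c::'f. infsum (\<lambda>p. ?f (pCons c p)) (- {0})) UNIV"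
  proof (rule infsum_Sigma'_banach [symmetric])
    show "(\<lambda>(c::'f, p). ?f (pCons c p)) summable_on (UNIV \<times> - {0})"
      using summ[of Y] unfolding Y_def
      by (subst (asm) summable_on_reindex[OF inj_pCons]) (simp add: o_def case_prod_unfold)
  qed
  also have "\<dots> = infsum (\<lambda>c::'f. infsum (\<lambda>p. ?q powr (- w) * ?f p) (- {0})) UNIV"
    by (intro infsum_cong) (simp add: ideal_norm_pCons powr_times_real ideal_norm_pos less_imp_le)
  also have "\<dots> = 0"
    using zero by (simp add: infsum_cmult_right' zeta_A_def)
  finally have "card (- {0::'f}) = 0" by (simp del: card_eq_0_iff)
  then have "- {0::'f} = {}" by simp
  moreover have "(1::'f) \<in> - {0}" by simp
  ultimately show False by blast
qed

section \<open>Moebius transformations and the imaginary absolute value\<close>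

lemma A_to_kinf_0 [simp]: "A_to_kinf 0 = 0"
  by (simp add: A_to_kinf_def)

lemma A_to_kinf_pCons: "A_to_kinf (pCons c p) = fls_const c + fls_X_inv * A_to_kinf p"
  by (simp add: A_to_kinf_def map_poly_pCons)

lemma A_to_kinf_add: "A_to_kinf (p + r) = A_to_kinf p + A_to_kinf r"
proof (induction p arbitrary: r)
  case (pCons c p)
  show ?case
    by (cases r) (simp add: A_to_kinf_pCons pCons.IH distrib_left flip: fls_plus_const)
qed simp

lemma A_to_kinf_smult: "A_to_kinf (smult c p) = fls_const c * A_to_kinf p"
  by (induction p) (simp_all add: A_to_kinf_pCons fls_const_mult_const algebra_simps)

lemma A_to_kinf_mult: "A_to_kinf (p * r) = A_to_kinf p * A_to_kinf r"
  by (induction p)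
    (simp_all add: A_to_kinf_pCons A_to_kinf_add A_to_kinf_smult algebra_simps)

text \<open>The Laurent variable is the inverse of \<open>T\<close>, so the leading term of a
  polynomial becomes the lowest term of the series. In \<open>c + T p\<close> with nonzero
  \<open>p\<close>, the second summand has strictly smaller order than the constant and decides the
  order of the sum.\<close>

lemma subdegree_A_to_kinf:
  "p \<noteq> 0 \<Longrightarrow> A_to_kinf p \<noteq> 0 \<and> fls_subdegree (A_to_kinf p) = - int (degree p)"
proof (induction p)
  case (pCons c p)
  show ?case
  proof (cases "p = 0")
    case True
    then show ?thesis using pCons by (simp add: A_to_kinf_pCons)
  next
    case False
    with pCons have IH: "A_to_kinf p \<noteq> 0" "fls_subdegree (A_to_kinf p) = - int (degree p)" by auto
    have nz: "fls_X_inv * A_to_kinf p \<noteq> 0" using IH by simp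
    have sd: "fls_subdegree (fls_X_inv * A_to_kinf p) = - int (Suc (degree p))"
      using IH by simp
    have "fls_subdegree (fls_const c + fls_X_inv * A_to_kinf p) = - int (Suc (degree p))"
      using fls_subdegree_add_eq2[OF nz, of "fls_const c"] sd by (cases "c = 0") auto
    then show ?thesis using False by (auto simp: A_to_kinf_pCons)
  qed
qed simp

lemma kinf_abs_A_to_kinf:
  fixes p :: "'f::{field,finite} poly"
  shows "p \<noteq> 0 \<Longrightarrow> kinf_abs (A_to_kinf p) = ideal_norm p"
  by (simp add: kinf_abs_def subdegree_A_to_kinf ideal_norm_def powr_realpow)

section \<open>The absolute value on \<open>C_infinity\<close>\<close>

locale C_infty =
  fixes \<iota> :: "'f::{field,finite} fls \<Rightarrow> 'c::field" and nv :: "'c \<Rightarrow> real"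
  assumes is_C_infty: "is_C_infty \<iota> nv"
begin

lemma iota_add: "\<iota> (x + y) = \<iota> x + \<iota> y"
  and iota_mult: "\<iota> (x * y) = \<iota> x * \<iota> y"
  and iota_1 [simp]: "\<iota> 1 = 1"
  and nv_nonneg [simp]: "nv u \<ge> 0"
  and nv_eq_0_iff [simp]: "nv u = 0 \<longleftrightarrow> u = 0"
  and nv_mult: "nv (u * v) = nv u * nv v"
  and nv_add_le: "nv (u + v) \<le> max (nv u) (nv v)"
  and nv_iota: "nv (\<iota> x) = kinf_abs x"
  using is_C_infty unfolding is_C_infty_def by (elim conjE, metis)+

lemma nv_0 [simp]: "nv 0 = 0"
  by simp

lemma iota_0 [simp]: "\<iota> 0 = 0"
  using iota_add[of 0 0] by (metis add_cancel_right_right)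

lemma iota_minus: "\<iota> (- x) = - \<iota> x"
  using iota_add[of x "- x"] by (simp add: add_eq_0_iff)

lemma iota_diff: "\<iota> (x - y) = \<iota> x - \<iota> y"
  using iota_add[of x "- y"] by (simp add: iota_minus)

lemma iota_eq_0_iff [simp]: "\<iota> x = 0 \<longleftrightarrow> x = 0"
  by (metis iota_0 kinf_abs_def nv_eq_0_iff nv_iota of_nat_0_less_iff powr_gt_zero
      less_irrefl zero_less_card_finite)

lemma iota_divide: "\<iota> (x / y) = \<iota> x / \<iota> y"
proof (cases "y = 0")
  case False
  then have "\<iota> (x / y) * \<iota> y = \<iota> x" by (simp flip: iota_mult)
  then show ?thesis using False by (simp add: field_simps)
qed simp

lemmas iota_simps = iota_add iota_mult iota_minus iota_diff iota_divide

lemma nv_pos_iff [simp]: "nv u > 0 \<longleftrightarrow> u \<noteq> 0"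
  using nv_nonneg[of u] nv_eq_0_iff[of u] by linarith

lemma nv_1 [simp]: "nv 1 = 1"
  using nv_mult[of 1 1] by simp

lemma nv_minus [simp]: "nv (- u) = nv u"
proof -
  have "(nv (- 1))\<^sup>2 = 1\<^sup>2" using nv_mult[of "-1" "-1"] by (simp add: power2_eq_square)
  then have "nv (- 1) = 1" by (rule power2_eq_imp_eq) simp_all
  then show ?thesis using nv_mult[of "-1" u] by simp
qed

lemma nv_diff_le: "nv (u - v) \<le> max (nv u) (nv v)"
  using nv_add_le[of u "- v"] by simp

lemma nv_divide: "nv (u / v) = nv u / nv v"
proof (cases "v = 0")
  case False
  then show ?thesis using nv_mult[of "u / v" v] by (simp add: field_simps)
qed simp

section \<open>The imaginary absolute value and its transformation law\<close>

lemma bdd_below_nv: "bdd_below (range (\<lambda>w. nv (z - \<iota> w)))"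
  by (rule bdd_belowI[of _ 0]) auto

lemma imag_abs_le: "imag_abs \<iota> nv z \<le> nv (z - \<iota> w)"
  unfolding imag_abs_def by (rule cINF_lower[OF bdd_below_nv]) simp

lemma imag_abs_greatest: "(\<And>w. K \<le> nv (z - \<iota> w)) \<Longrightarrow> K \<le> imag_abs \<iota> nv z"
  unfolding imag_abs_def by (rule cINF_greatest) auto

lemma imag_abs_nonneg [simp]: "imag_abs \<iota> nv z \<ge> 0"
  by (rule imag_abs_greatest) simp

text \<open>For nonzero \<open>c\<close>, the form equals \<open>c (z - w)\<close> with
  \<open>w = - d / c\<close>, and this \<open>w\<close> competes in the infimum.\<close>

lemma imag_abs_mult_le: "nv (\<iota> c) * imag_abs \<iota> nv z \<le> nv (\<iota> c * z + \<iota> d)"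
proof (cases "c = 0")
  case False
  have "\<iota> c * z + \<iota> d = \<iota> c * (z - \<iota> (- d / c))"
    using False by (simp add: iota_simps field_simps)
  then have "nv (\<iota> c * z + \<iota> d) = nv (\<iota> c) * nv (z - \<iota> (- d / c))" by (simp add: nv_mult)
  then show ?thesis using imag_abs_le by (simp add: mult_left_mono)
qed simp

lemma linear_form_nonzero:
  assumes "z \<in> Omega \<iota>" "c \<noteq> 0 \<or> d \<noteq> 0"
  shows "\<iota> c * z + \<iota> d \<noteq> 0"
proof
  assume *: "\<iota> c * z + \<iota> d = 0"
  then have c: "c \<noteq> 0" using assms(2) by auto
  have "z = \<iota> (- d / c)" using * c by (simp add: iota_simps field_simps add_eq_0_iff)
  then show False using assms(1) by (simp add: Omega_def)
qed

text \<open>The bound is proved for each competitor \<open>w\<close>. The difference of the image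
  point and \<open>w\<close> is a linear form in \<open>z\<close> divided by \<open>j\<close>, and
  the ultrametric inequality bounds that form from below.\<close>

lemma imag_abs_moebius_ge:
  assumes z: "z \<in> Omega \<iota>" and det: "a * d - b * c \<noteq> 0"
  defines "j \<equiv> \<iota> c * z + \<iota> d"
  shows "nv (\<iota> (a * d - b * c)) * imag_abs \<iota> nv z / (nv j)\<^sup>2 \<le> imag_abs \<iota> nv ((\<iota> a * z + \<iota> b) / j)"
proof (rule imag_abs_greatest)
  fix w
  let ?D = "a * d - b * c" and ?i = "imag_abs \<iota> nv z"
  have j0: "j \<noteq> 0" unfolding j_def using det by (intro linear_form_nonzero[OF z]) auto
  have cj: "nv (\<iota> c) * ?i \<le> nv j" unfolding j_def by (rule imag_abs_mult_le)
  have diff: "(\<iota> a * z + \<iota> b) / j - \<iota> w = (\<iota> (a - w * c) * z + \<iota> (b - w * d)) / j"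
    using j0 by (simp add: divide_simps iota_simps) (simp add: j_def algebra_simps)
  show "nv (\<iota> ?D) * ?i / (nv j)\<^sup>2 \<le> nv ((\<iota> a * z + \<iota> b) / j - \<iota> w)"
  proof (cases "a - w * c = 0")
    \<comment> \<open>Here \<open>w = a / c\<close> is the image of infinity, and the linear form is
      constant.\<close>
    case True
    then have "?D = - c * (b - w * d)" by (simp add: algebra_simps)
    then have "nv (\<iota> ?D) = nv (\<iota> c) * nv (\<iota> (b - w * d))"
      by (simp only: iota_mult nv_mult iota_minus nv_minus)
    then have "nv (\<iota> ?D) * ?i = (nv (\<iota> c) * ?i) * nv (\<iota> (b - w * d))" by simp
    also have "\<dots> \<le> nv j * nv (\<iota> (b - w * d))" using cj by (intro mult_right_mono) auto
    finally show ?thesis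
      unfolding diff True using j0 by (simp add: nv_divide field_simps power2_eq_square)
  next
    case False
    define \<alpha> where "\<alpha> = a - w * c"
    \<comment> \<open>The preimage of \<open>w\<close> under the matrix; the numerator is then
      \<open>\<alpha> (z - w')\<close> and the determinant
      \<open>\<alpha> (c w' + d)\<close>.\<close>
    define w' where "w' = (w * d - b) / \<alpha>"
    have \<alpha>: "\<alpha> \<noteq> 0" using False by (simp add: \<alpha>_def)
    have D: "?D = \<alpha> * (c * w' + d)"
      using \<alpha> by (simp add: w'_def field_simps) (simp add: \<alpha>_def algebra_simps)
    have "\<iota> \<alpha> * \<iota> w' = \<iota> (w * d - b)" using \<alpha> by (simp add: w'_def flip: iota_mult)
    then have num: "\<iota> (a - w * c) * z + \<iota> (b - w * d) = \<iota> \<alpha> * (z - \<iota> w')"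
      unfolding \<alpha>_def [symmetric] by (simp add: right_diff_distrib iota_diff)
    have iw: "?i \<le> nv (z - \<iota> w')" by (rule imag_abs_le)
    have "nv (\<iota> (c * w' + d)) * ?i \<le> nv j * nv (z - \<iota> w')"
    proof (cases "nv (\<iota> (c * w' + d)) \<le> nv j")
      case True
      then show ?thesis using iw by (intro mult_mono) auto
    next
      case f: False
      \<comment> \<open>Since \<open>c w' + d\<close> now exceeds \<open>j\<close> in absolute
        value, the ultrametric inequality leaves only the term \<open>c (z - w')\<close> as a bound
        for it. The factor of \<open>c\<close> is then absorbed by \<open>cj\<close>.\<close>
      have "\<iota> (c * w' + d) = j - \<iota> c * (z - \<iota> w')"
        by (simp add: j_def iota_simps algebra_simps)
      then have "nv (\<iota> (c * w' + d)) \<le> max (nv j) (nv (\<iota> c) * nv (z - \<iota> w'))"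
        using nv_diff_le[of j "\<iota> c * (z - \<iota> w')"] by (simp add: nv_mult)
      then have "nv (\<iota> (c * w' + d)) \<le> nv (\<iota> c) * nv (z - \<iota> w')" using f by auto
      then have "nv (\<iota> (c * w' + d)) * ?i \<le> nv (\<iota> c) * nv (z - \<iota> w') * ?i"
        by (intro mult_right_mono) auto
      also have "\<dots> = (nv (\<iota> c) * ?i) * nv (z - \<iota> w')" by simp
      also have "\<dots> \<le> nv j * nv (z - \<iota> w')" using cj by (intro mult_right_mono) auto
      finally show ?thesis .
    qed
    then have "nv (\<iota> \<alpha>) * (nv (\<iota> (c * w' + d)) * ?i) \<le> nv (\<iota> \<alpha>) * (nv j * nv (z - \<iota> w'))"
      by (intro mult_left_mono) auto
    then have "nv (\<iota> ?D) * ?i \<le> nv (\<iota> \<alpha>) * nv j * nv (z - \<iota> w')"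
      unfolding D by (simp add: iota_mult nv_mult)
    then show ?thesis
      unfolding diff num nv_divide nv_mult using j0 by (simp add: field_simps power2_eq_square)
  qed
qed

text \<open>If the image were some \<open>w\<close> in \<open>k_infinity\<close>, a linear form in
  \<open>z\<close> would vanish, hence both its coefficients; the top row would be \<open>w\<close>
  times the bottom row and the determinant zero.\<close>

lemma moebius_in_Omega:
  assumes z: "z \<in> Omega \<iota>" and det: "a * d - b * c \<noteq> 0"
  shows "(\<iota> a * z + \<iota> b) / (\<iota> c * z + \<iota> d) \<in> Omega \<iota>"
proof -
  have j0: "\<iota> c * z + \<iota> d \<noteq> 0" using det by (intro linear_form_nonzero[OF z]) auto
  have "(\<iota> a * z + \<iota> b) / (\<iota> c * z + \<iota> d) \<noteq> \<iota> w" for w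
  proof
    assume "(\<iota> a * z + \<iota> b) / (\<iota> c * z + \<iota> d) = \<iota> w"
    then have "\<iota> (a - w * c) * z + \<iota> (b - w * d) = 0"
      using j0 by (simp add: field_simps iota_simps)
    then have "a - w * c = 0" "b - w * d = 0" using linear_form_nonzero[OF z] by blast+
    then have "a = w * c" "b = w * d" by auto
    then show False using det by (simp add: algebra_simps)
  qed
  then show ?thesis by (auto simp: Omega_def)
qed

text \<open>The inverse matrix turns the lower bound into the matching upper bound.\<close>

lemma imag_abs_moebius:
  assumes z: "z \<in> Omega \<iota>" and det: "a * d - b * c \<noteq> 0"
  shows "imag_abs \<iota> nv ((\<iota> a * z + \<iota> b) / (\<iota> c * z + \<iota> d)) =
    nv (\<iota> (a * d - b * c)) * imag_abs \<iota> nv z / (nv (\<iota> c * z + \<iota> d))\<^sup>2"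
proof -
  define j where "j = \<iota> c * z + \<iota> d"
  define v where "v = (\<iota> a * z + \<iota> b) / j"
  let ?D = "a * d - b * c"
  have j0: "j \<noteq> 0" unfolding j_def using det by (intro linear_form_nonzero[OF z]) auto
  have v: "v \<in> Omega \<iota>" unfolding v_def j_def using z det by (rule moebius_in_Omega)
  have vj: "v * j = \<iota> a * z + \<iota> b" using j0 by (simp add: v_def)
  \<comment> \<open>The adjugate matrix \<open>(d, -b; -c, a)\<close> has the same determinant and
    maps \<open>v\<close> back to \<open>z\<close>; its denominator and numerator at
    \<open>v\<close> are computed after multiplication by \<open>j\<close>.\<close>
  have "(\<iota> (- c) * v + \<iota> a) * j = \<iota> a * j - \<iota> c * (v * j)" by (simp add: iota_simps algebra_simps)
  also have "\<dots> = \<iota> ?D" unfolding vj by (simp add: j_def iota_simps algebra_simps)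
  finally have den: "\<iota> (- c) * v + \<iota> a = \<iota> ?D / j" using j0 by (simp add: field_simps)
  have "(\<iota> d * v + \<iota> (- b)) * j = \<iota> d * (v * j) - \<iota> b * j" by (simp add: iota_simps algebra_simps)
  also have "\<dots> = \<iota> ?D * z" unfolding vj by (simp add: j_def iota_simps algebra_simps)
  finally have num: "\<iota> d * v + \<iota> (- b) = \<iota> ?D * z / j" using j0 by (simp add: field_simps)
  have D': "d * a - (- b) * (- c) = ?D" by (simp add: algebra_simps)
  have "(\<iota> d * v + \<iota> (- b)) / (\<iota> (- c) * v + \<iota> a) = z"
    unfolding num den using j0 det by (simp add: field_simps)
  with imag_abs_moebius_ge[OF v, of d a "- b" "- c"] det
  have "nv (\<iota> ?D) * imag_abs \<iota> nv v / (nv (\<iota> ?D / j))\<^sup>2 \<le> imag_abs \<iota> nv z"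
    unfolding D' den by simp
  then have "imag_abs \<iota> nv v * (nv j)\<^sup>2 / nv (\<iota> ?D) \<le> imag_abs \<iota> nv z"
    using det j0 by (simp add: nv_divide power_divide power2_eq_square)
  moreover have "nv (\<iota> ?D) > 0" "nv j > 0" using det j0 by simp_all
  ultimately have "imag_abs \<iota> nv v \<le> nv (\<iota> ?D) * imag_abs \<iota> nv z / (nv j)\<^sup>2"
    by (simp add: field_simps)
  moreover have "nv (\<iota> ?D) * imag_abs \<iota> nv z / (nv j)\<^sup>2 \<le> imag_abs \<iota> nv v"
    unfolding v_def j_def using imag_abs_moebius_ge[OF z det] .
  ultimately show ?thesis unfolding v_def j_def by linarith
qed

end

section \<open>Cosets and primitive vectors\<close>

definition coset_of_row :: "'f::field poly \<Rightarrow> 'f poly \<Rightarrow> 'f mat2 set" where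
  "coset_of_row c d = {g \<in> GL2A. \<exists>k. k \<noteq> 0 \<and> snd (snd g) = (smult k c, smult k d)}"

text \<open>An upper triangular matrix in \<open>GL2A\<close> scales the bottom row by a diagonal
  entry, which is a unit. Conversely, two matrices in \<open>GL2A\<close> whose bottom rows differ
  by a unit have a quotient with lower left entry 0.\<close>

lemma coset_eq_coset_of_row:
  assumes g: "(a, b, c, d) \<in> GL2A"
  shows "(\<lambda>h. mat_mult h (a, b, c, d)) ` GL2A_inf = coset_of_row c d"
proof (intro equalityI subsetI)
  obtain u where u: "u \<noteq> 0" "a * d - b * c = [:u:]" using g by (auto simp: GL2A_def)
  {
    fix g assume "g \<in> (\<lambda>h. mat_mult h (a, b, c, d)) ` GL2A_inf"
    then obtain \<alpha> \<beta> \<delta> v where h: "v \<noteq> 0" "\<alpha> * \<delta> = [:v:]"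
      and g: "g = mat_mult (\<alpha>, \<beta>, 0, \<delta>) (a, b, c, d)"
      by (auto simp: GL2A_inf_def GL2A_def)
    have "\<delta> dvd [:v:]" using h by (metis dvd_triv_right)
    then have "degree \<delta> = 0" using h(1) by (metis dvd_imp_degree_le degree_pCons_0 le_zero_eq pCons_eq_0_iff)
    then obtain k where k: "\<delta> = [:k:]" by (rule degree_eq_zeroE)
    have "k \<noteq> 0" using h k by auto
    moreover have "(\<alpha> * a + \<beta> * c) * (\<delta> * d) - (\<alpha> * b + \<beta> * d) * (\<delta> * c) = [:v * u:]"
    proof -
      have "(\<alpha> * a + \<beta> * c) * (\<delta> * d) - (\<alpha> * b + \<beta> * d) * (\<delta> * c) = (\<alpha> * \<delta>) * (a * d - b * c)"
        by (simp add: algebra_simps)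
      then show ?thesis by (simp only: h u) simp
    qed
    ultimately show "g \<in> coset_of_row c d"
      using h u unfolding g coset_of_row_def GL2A_def mat_mult_def by (auto simp: k)
  next
    fix g assume "g \<in> coset_of_row c d"
    then obtain a' b' k v where g: "g = (a', b', smult k c, smult k d)" "k \<noteq> 0" "v \<noteq> 0"
      "a' * smult k d - b' * smult k c = [:v:]"
      unfolding coset_of_row_def GL2A_def by force
    \<comment> \<open>The witness below is \<open>g\<close> times the inverse of
      \<open>(a, b; c, d)\<close>, computed from the adjugate; its bottom row is
      \<open>(0, k)\<close>.\<close>
    let ?i = "smult (inverse u)"
    have det: "smult k (a' * d - b' * c) = [:v:]" using g(4) by (simp add: smult_diff_right)
    have "?i (a' * d - b' * c) * [:k:] - ?i (b' * a - a' * b) * 0 = ?i (smult k (a' * d - b' * c))"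
      by (simp add: mult.commute)
    also have "\<dots> = [:inverse u * v:]" unfolding det by simp
    finally have "(?i (a' * d - b' * c), ?i (b' * a - a' * b), 0, [:k:]) \<in> GL2A"
      using g(3) u(1) unfolding GL2A_def mem_Collect_eq prod.case by (intro exI conjI) auto
    then have "(?i (a' * d - b' * c), ?i (b' * a - a' * b), 0, [:k:]) \<in> GL2A_inf"
      by (simp add: GL2A_inf_def)
    moreover have "?i (a' * d - b' * c) * a + ?i (b' * a - a' * b) * c = ?i (a' * (a * d - b * c))"
      "?i (a' * d - b' * c) * b + ?i (b' * a - a' * b) * d = ?i (b' * (a * d - b * c))"
      by (simp_all add: algebra_simps flip: smult_add_right smult_diff_right)
    then have "g = mat_mult (?i (a' * d - b' * c), ?i (b' * a - a' * b), 0, [:k:]) (a, b, c, d)"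
      unfolding mat_mult_def u g(1) using u(1) by simp
    ultimately show "g \<in> (\<lambda>h. mat_mult h (a, b, c, d)) ` GL2A_inf" by blast
  }
qed

lemma cosets_inf_eq: "cosets_inf = {coset_of_row c d | a b c d. (a, b, c, d) \<in> GL2A}"
proof (intro equalityI subsetI)
  fix C :: "'a mat2 set" assume "C \<in> cosets_inf"
  then obtain g where g: "g \<in> GL2A" "C = (\<lambda>h. mat_mult h g) ` GL2A_inf"
    by (auto simp: cosets_inf_def)
  obtain a b c d where "g = (a, b, c, d)" by (cases g)
  then show "C \<in> {coset_of_row c d | a b c d. (a, b, c, d) \<in> GL2A}"
    using g coset_eq_coset_of_row by blast
next
  fix C :: "'a mat2 set" assume "C \<in> {coset_of_row c d | a b c d. (a, b, c, d) \<in> GL2A}"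
  then show "C \<in> cosets_inf"
    unfolding cosets_inf_def using coset_eq_coset_of_row by blast
qed

lemma coset_of_row_smult:
  assumes "k \<noteq> 0"
  shows "coset_of_row (smult k c) (smult k d) = coset_of_row c d"
proof (intro equalityI subsetI)
  fix g assume "g \<in> coset_of_row (smult k c) (smult k d)"
  then show "g \<in> coset_of_row c d"
    using assms by (auto simp: coset_of_row_def) (metis mult_eq_0_iff)
next
  fix g assume "g \<in> coset_of_row c d"
  then obtain l where g: "g \<in> GL2A" "l \<noteq> 0" "snd (snd g) = (smult l c, smult l d)"
    by (auto simp: coset_of_row_def)
  have "l / k \<noteq> 0" "snd (snd g) = (smult (l / k) (smult k c), smult (l / k) (smult k d))"
    using g assms by auto
  with g(1) show "g \<in> coset_of_row (smult k c) (smult k d)"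
    unfolding coset_of_row_def by blast
qed

text \<open>Bottom rows are primitive: expanding the determinant writes a unit times
  \<open>m\<close> as a combination of \<open>m * c\<close> and \<open>m * d\<close>, hence as a
  multiple of \<open>m'\<close>. By symmetry \<open>m\<close> and \<open>m'\<close> divide each
  other and differ by a nonzero constant.\<close>

lemma GL2A_proportional_rows:
  assumes "(a, b, c, d) \<in> GL2A" "(a', b', c', d') \<in> GL2A"
    and m: "m \<noteq> 0" "m' \<noteq> 0" "m * c = m' * c'" "m * d = m' * d'"
  obtains k where "k \<noteq> 0" "c' = smult k c" "d' = smult k d"
proof -
  obtain u u' where u: "u \<noteq> 0" "a * d - b * c = [:u:]" "u' \<noteq> 0" "a' * d' - b' * c' = [:u':]"
    using assms by (auto simp: GL2A_def)
  have "m * [:u:] = a * (m * d) - b * (m * c)"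
    unfolding u(2)[symmetric] by (simp add: algebra_simps)
  also have "\<dots> = m' * (a * d' - b * c')" unfolding m by (simp add: algebra_simps)
  finally have "m' dvd smult u m" by simp
  then have 1: "m' dvd m" using u by (simp add: dvd_smult_iff)
  have "m' * [:u':] = a' * (m' * d') - b' * (m' * c')"
    unfolding u(4)[symmetric] by (simp add: algebra_simps)
  also have "\<dots> = m * (a' * d - b' * c)" unfolding m[symmetric] by (simp add: algebra_simps)
  finally have "m dvd smult u' m'" by simp
  then have 2: "m dvd m'" using u by (simp add: dvd_smult_iff)
  from 1 obtain t where t: "m = m' * t" by (auto elim: dvdE)
  have "degree m = degree m'" using 1 2 m by (meson dvd_imp_degree_le le_antisym)
  then have "degree t = 0" using m t by (auto simp: degree_mult_eq)
  then obtain k where k: "t = [:k:]" by (rule degree_eq_zeroE)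
  have "k \<noteq> 0" using m t k by auto
  moreover have "m' * c' = m' * smult k c" "m' * d' = m' * smult k d"
    using m(3,4) by (simp_all add: t k)
  then have "c' = smult k c" "d' = smult k d" using m(2) by (metis mult_cancel_left)+
  ultimately show ?thesis using that by blast
qed

text \<open>The choice made inside \<open>Eis\<close>, named so that its summand can be folded; only
  membership in the coset is known of it.\<close>

definition coset_rep :: "'f::field mat2 set \<Rightarrow> 'f mat2" where
  "coset_rep C = (SOME g. g \<in> C)"

definition coset_row :: "'f::field mat2 set \<Rightarrow> 'f poly \<times> 'f poly" where
  "coset_row C = snd (snd (coset_rep C))"

lemma coset_rep_in:
  assumes "C \<in> cosets_inf"
  shows "coset_rep C \<in> C"
proof -
  obtain a b c d where *: "(a, b, c, d) \<in> GL2A" "C = coset_of_row c d"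
    using assms by (auto simp: cosets_inf_eq)
  then have "(a, b, c, d) \<in> C" by (auto simp: coset_of_row_def intro!: exI[of _ 1])
  then show ?thesis unfolding coset_rep_def by (rule someI)
qed

lemma coset_rep_GL2A: "C \<in> cosets_inf \<Longrightarrow> coset_rep C \<in> GL2A"
  using coset_rep_in[of C] by (auto simp: cosets_inf_eq coset_of_row_def)

lemma coset_of_coset_row:
  assumes "C \<in> cosets_inf"
  shows "coset_of_row (fst (coset_row C)) (snd (coset_row C)) = C"
proof -
  obtain a b c d where C: "C = coset_of_row c d"
    using assms by (auto simp: cosets_inf_eq)
  then obtain k where "k \<noteq> 0" "coset_row C = (smult k c, smult k d)"
    using coset_rep_in[OF assms] unfolding coset_row_def by (auto simp: coset_of_row_def)
  then show ?thesis by (simp add: C coset_of_row_smult)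
qed

lemma coset_row_nonzero:
  assumes "C \<in> cosets_inf"
  shows "coset_row C \<noteq> (0, 0)"
  using coset_rep_GL2A[OF assms] by (auto simp: coset_row_def GL2A_def)

text \<open>Every nonzero vector is a scalar multiple of a primitive one, and primitive vectors up to
  units are the bottom rows of the cosets.\<close>

lemma bij_betw_coset_row:
  "bij_betw (\<lambda>(m, C). (m * fst (coset_row C), m * snd (coset_row C)))
     ((- {0}) \<times> (cosets_inf :: 'f::field mat2 set set)) (- {(0, 0)})"
proof (rule bij_betw_imageI)
  show "inj_on (\<lambda>(m, C). (m * fst (coset_row C), m * snd (coset_row C)))
     ((- {0}) \<times> (cosets_inf :: 'f mat2 set set))"
  proof -
    have inj: "m = m' \<and> C = C'"
      if C: "C \<in> cosets_inf" "C' \<in> cosets_inf" and m: "m \<noteq> 0" "m' \<noteq> 0"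
        and eq: "m * fst (coset_row C) = m' * fst (coset_row C')"
          "m * snd (coset_row C) = m' * snd (coset_row C')"
      for m m' and C C' :: "'f mat2 set"
    proof -
      obtain a b a' b' where
        "(a, b, fst (coset_row C), snd (coset_row C)) \<in> GL2A"
        "(a', b', fst (coset_row C'), snd (coset_row C')) \<in> GL2A"
        using coset_rep_GL2A[OF C(1)] coset_rep_GL2A[OF C(2)]
        unfolding coset_row_def by (metis prod.collapse)
      then obtain k where "k \<noteq> 0" "fst (coset_row C') = smult k (fst (coset_row C))"
        "snd (coset_row C') = smult k (snd (coset_row C))"
        using m eq by (rule GL2A_proportional_rows)
      then have "C' = C"
        using coset_of_coset_row[OF C(1)] coset_of_coset_row[OF C(2)]
          coset_of_row_smult by metis
      then show ?thesis
        using eq coset_row_nonzero[OF C(1)] by (auto simp: prod_eq_iff)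
    qed
    show ?thesis
    proof (rule inj_onI)
      fix v w :: "'f poly \<times> 'f mat2 set"
      assume v: "v \<in> (- {0}) \<times> cosets_inf" and w: "w \<in> (- {0}) \<times> cosets_inf"
        and "(\<lambda>(m, C). (m * fst (coset_row C), m * snd (coset_row C))) v =
             (\<lambda>(m, C). (m * fst (coset_row C), m * snd (coset_row C))) w"
      then show "v = w"
        using inj[of "snd v" "snd w" "fst v" "fst w"]
        by (simp add: case_prod_unfold mem_Times_iff prod_eq_iff)
    qed
  qed
next
  show "(\<lambda>(m, C). (m * fst (coset_row C), m * snd (coset_row C))) `
     ((- {0}) \<times> (cosets_inf :: 'f mat2 set set)) = - {(0, 0)}"
  proof (intro equalityI subsetI)
    fix v assume "v \<in> (\<lambda>(m, C). (m * fst (coset_row C), m * snd (coset_row C))) `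
     ((- {0}) \<times> (cosets_inf :: 'f mat2 set set))"
    then obtain m and C :: "'f mat2 set" where "m \<noteq> 0" "C \<in> cosets_inf"
      "v = (m * fst (coset_row C), m * snd (coset_row C))" by auto
    then show "v \<in> - {(0, 0)}" using coset_row_nonzero[of C] by (auto simp: prod_eq_iff)
  next
    fix v :: "'f poly \<times> 'f poly" assume v: "v \<in> - {(0, 0)}"
    obtain x y where xy: "v = (x, y)" by (cases v)
    obtain g p r x' y' where g: "g = p * x + r * y" "x = g * x'" "y = g * y'"
      by (rule poly_bezout)
    have g0: "g \<noteq> 0" using v xy g(2,3) by auto
    have "g * (p * x' + r * y') = p * (g * x') + r * (g * y')" by (simp add: algebra_simps)
    also have "\<dots> = g * 1" unfolding g(2,3)[symmetric] g(1)[symmetric] by simp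
    finally have "g * (p * x' + r * y') = g * 1" .
    then have "p * x' + r * y' = 1" using g0 by (subst (asm) mult_cancel_left) auto
    \<comment> \<open>The Bezout coefficients complete the primitive row to a matrix of determinant
      1.\<close>
    then have "(r, - p, x', y') \<in> GL2A"
      by (auto simp: GL2A_def algebra_simps one_pCons intro!: exI[of _ 1])
    then have C: "coset_of_row x' y' \<in> cosets_inf" unfolding cosets_inf_eq by blast
    \<comment> \<open>The chosen row may differ from \<open>(x', y')\<close> by a constant
      \<open>k\<close>, which is compensated by dividing the multiplier \<open>g\<close> by
      \<open>k\<close>.\<close>
    obtain k where k: "k \<noteq> 0" "coset_row (coset_of_row x' y') = (smult k x', smult k y')"
      using coset_rep_in[OF C] unfolding coset_row_def by (auto simp: coset_of_row_def)
    have "v = (\<lambda>(m, C). (m * fst (coset_row C), m * snd (coset_row C)))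
        (smult (inverse k) g, coset_of_row x' y')"
      using k by (simp add: xy flip: g(2,3))
    moreover have "smult (inverse k) g \<in> - {0}" using k g0 by simp
    ultimately show "v \<in> (\<lambda>(m, C). (m * fst (coset_row C), m * snd (coset_row C))) `
     ((- {0}) \<times> (cosets_inf :: 'f mat2 set set))" using C by blast
  qed
qed

section \<open>Eisenstein series and Hecke operators\<close>

text \<open>Complex powers of positive reals are multiplicative, as the logarithms involved are
  real. For \<open>i = 0\<close> both sides vanish because \<open>0 powr s = 0\<close>.\<close>

lemma of_real_powr_div_square:
  assumes "i \<ge> 0" "L > 0"
  shows "complex_of_real (i / L\<^sup>2) powr s = complex_of_real i powr s * complex_of_real L powr (- (2 * s))"
proof (cases "i = 0")
  case False
  then have "i > 0" using assms by simp
  then have ln: "ln (i / L\<^sup>2) = ln i - 2 * ln L"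
    using assms by (simp add: ln_div ln_realpow)
  then show ?thesis
    using \<open>i > 0\<close> assms
    by (simp add: powr_def Ln_of_real ln exp_add [symmetric] algebra_simps
        del: of_real_divide of_real_power)
qed simp

lemma sum_infsum_swap:
  fixes f :: "'i \<Rightarrow> 'a \<Rightarrow> 'b::{topological_comm_monoid_add, t2_space}"
  assumes "finite I" "\<And>i. i \<in> I \<Longrightarrow> f i summable_on A"
  shows "(\<Sum>i\<in>I. infsum (f i) A) = (\<Sum>\<^sub>\<infinity>x\<in>A. \<Sum>i\<in>I. f i x)"
proof -
  have "((\<lambda>x. \<Sum>i\<in>I. f i x) has_sum (\<Sum>i\<in>I. infsum (f i) A)) A"
    using assms by (induction I) (auto intro!: has_sum_add)
  then show ?thesis by (simp add: infsumI)
qed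

text \<open>Both sides count each vector \<open>v\<close> with the number of sublattices of index \<open>n\<close>
  containing it.\<close>

lemma sum_hecke_matrices_infsum:
  fixes n :: "'f::{field,finite} poly" and f :: "'f poly \<times> 'f poly \<Rightarrow> complex"
  assumes n: "lead_coeff n = 1" and f: "f summable_on - {(0, 0)}"
  shows "(\<Sum>(a, b, d)\<in>hecke_matrices n. \<Sum>\<^sub>\<infinity>(x, y)\<in>- {(0, 0)}. f (x * a, x * b + y * d)) =
    (\<Sum>g | lead_coeff g = 1 \<and> g dvd n.
       complex_of_real (ideal_norm g) * (\<Sum>\<^sub>\<infinity>(x, y)\<in>- {(0, 0)}. f (g * x, g * y)))"
proof -
  let ?V = "- {(0, 0)} :: ('f poly \<times> 'f poly) set"
  have n0: "n \<noteq> 0" using n by auto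
  define P where "P v = (\<lambda>(a, b, d). \<exists>c e. fst v = c * a \<and> snd v = c * b + e * d)"
    for v :: "'f poly \<times> 'f poly"
  define Q where "Q v g \<longleftrightarrow> g dvd fst v \<and> g dvd snd v" for v :: "'f poly \<times> 'f poly" and g
  let ?D = "{g. lead_coeff g = 1 \<and> g dvd n}"
  have finD: "finite ?D" using n0 by (rule finite_monic_divisors)
  have finH: "finite (hecke_matrices n)" using n0 by (rule finite_hecke_matrices)
  \<comment> \<open>Stated for any condition \<open>R\<close> and factor \<open>z\<close>, so that
    it serves both for \<open>P\<close> with factor 1 and for \<open>Q\<close> with factor
    \<open>ideal_norm g\<close>.\<close>
  have summ: "(\<lambda>v. if R v then z * f v else 0) summable_on ?V" for R z
  proof -
    have "(\<lambda>v. z * f v) summable_on {v \<in> ?V. R v}"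
      by (intro summable_on_cmult_right summable_on_subset_banach[OF f]) auto
    then show ?thesis
      by (rule summable_on_cong_neutral[THEN iffD1, rotated -1]) auto
  qed
  \<comment> \<open>As \<open>a\<close> and \<open>d\<close> are nonzero, the vectors
    \<open>(x a, x b + y d)\<close> run once through the nonzero elements of the sublattice spanned
    by \<open>(a, b)\<close> and \<open>(0, d)\<close>, for which \<open>P\<close> is the membership
    test. The factor 1 gives the summand the shape of \<open>summ\<close>.\<close>
  have L: "(\<Sum>\<^sub>\<infinity>(x, y)\<in>?V. f (x * a, x * b + y * d)) =
      (\<Sum>\<^sub>\<infinity>v\<in>?V. if P v (a, b, d) then 1 * f v else 0)" if H: "(a, b, d) \<in> hecke_matrices n" for a b d
  proof -
    have nz: "a \<noteq> 0" "d \<noteq> 0" using H n0 by (auto simp: hecke_matrices_def)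
    let ?h = "\<lambda>(x, y). (x * a, x * b + y * d)"
    have inj: "inj_on ?h ?V" using nz by (auto simp: inj_on_def)
    have "(\<Sum>\<^sub>\<infinity>(x, y)\<in>?V. f (x * a, x * b + y * d)) = infsum f (?h ` ?V)"
      by (subst infsum_reindex[OF inj]) (simp add: o_def case_prod_unfold)
    also have "\<dots> = (\<Sum>\<^sub>\<infinity>v\<in>?V. if P v (a, b, d) then 1 * f v else 0)"
    proof (rule infsum_cong_neutral)
      fix v assume v: "v \<in> ?V - ?h ` ?V"
      have "\<not> P v (a, b, d)"
      proof
        assume "P v (a, b, d)"
        then obtain c e where "v = ?h (c, e)" unfolding P_def by (auto simp: prod_eq_iff)
        moreover from this v have "(c, e) \<in> ?V" by auto
        ultimately show False using v by blast
      qed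
      then show "(if P v (a, b, d) then 1 * f v else 0) = 0" by simp
    next
      fix v assume "v \<in> ?h ` ?V - ?V"
      then show "f v = 0" using nz by auto
    next
      fix v assume "v \<in> ?h ` ?V \<inter> ?V"
      then have "P v (a, b, d)" by (auto simp: P_def)
      then show "f v = (if P v (a, b, d) then 1 * f v else 0)" by simp
    qed
    finally show ?thesis .
  qed
  have R: "(\<Sum>\<^sub>\<infinity>v\<in>?V. if Q v g then complex_of_real (ideal_norm g) * f v else 0) =
      complex_of_real (ideal_norm g) * (\<Sum>\<^sub>\<infinity>(x, y)\<in>?V. f (g * x, g * y))" if g: "g \<in> ?D" for g
  proof -
    have nz: "g \<noteq> 0" using g by auto
    let ?h = "\<lambda>(x, y). (g * x, g * y)"
    have inj: "inj_on ?h ?V" using nz by (auto simp: inj_on_def)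
    have "(\<Sum>\<^sub>\<infinity>(x, y)\<in>?V. f (g * x, g * y)) = infsum f (?h ` ?V)"
      by (subst infsum_reindex[OF inj]) (simp add: o_def case_prod_unfold)
    then have "complex_of_real (ideal_norm g) * (\<Sum>\<^sub>\<infinity>(x, y)\<in>?V. f (g * x, g * y)) =
        (\<Sum>\<^sub>\<infinity>v\<in>?h ` ?V. complex_of_real (ideal_norm g) * f v)"
      by (simp add: infsum_cmult_right')
    also have "\<dots> = (\<Sum>\<^sub>\<infinity>v\<in>?V. if Q v g then complex_of_real (ideal_norm g) * f v else 0)"
    proof (rule infsum_cong_neutral)
      fix v assume v: "v \<in> ?V - ?h ` ?V"
      have "\<not> Q v g"
      proof
        assume "Q v g"
        then obtain c e where "v = ?h (c, e)" unfolding Q_def dvd_def by (auto simp: prod_eq_iff)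
        moreover from this v have "(c, e) \<in> ?V" by auto
        ultimately show False using v by blast
      qed
      then show "(if Q v g then complex_of_real (ideal_norm g) * f v else 0) = 0" by simp
    next
      fix v assume "v \<in> ?h ` ?V - ?V"
      then show "complex_of_real (ideal_norm g) * f v = 0" using nz by auto
    next
      fix v assume "v \<in> ?h ` ?V \<inter> ?V"
      then have "Q v g" by (auto simp: Q_def)
      then show "complex_of_real (ideal_norm g) * f v =
          (if Q v g then complex_of_real (ideal_norm g) * f v else 0)" by simp
    qed
    finally show ?thesis ..
  qed
  have "(\<Sum>(a, b, d)\<in>hecke_matrices n. \<Sum>\<^sub>\<infinity>(x, y)\<in>?V. f (x * a, x * b + y * d)) =
      (\<Sum>M\<in>hecke_matrices n. \<Sum>\<^sub>\<infinity>v\<in>?V. if P v M then 1 * f v else 0)"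
    by (intro sum.cong refl) (clarsimp simp only: L split: prod.splits)
  \<comment> \<open>All series now have the same index set, so the finite sums move inside and the
    multiplicities can be compared vector by vector.\<close>
  also have "\<dots> = (\<Sum>\<^sub>\<infinity>v\<in>?V. \<Sum>M\<in>hecke_matrices n. if P v M then 1 * f v else 0)"
    by (rule sum_infsum_swap[OF finH summ])
  also have "\<dots> = (\<Sum>\<^sub>\<infinity>v\<in>?V. \<Sum>g\<in>?D. if Q v g then complex_of_real (ideal_norm g) * f v else 0)"
  proof (rule infsum_cong)
    fix v
    have "(\<Sum>M\<in>hecke_matrices n. if P v M then 1 * f v else 0) =
        of_nat (card {M \<in> hecke_matrices n. P v M}) * f v"
      using finH by (simp flip: sum.inter_filter)
    also have "{M \<in> hecke_matrices n. P v M} =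
        {(a, b, d) \<in> hecke_matrices n. \<exists>c e. fst v = c * a \<and> snd v = c * b + e * d}"
      by (auto simp: P_def)
    also have "card \<dots> = (\<Sum>g | g \<in> ?D \<and> Q v g. CARD('f) ^ degree g)"
      unfolding card_hecke_matrices_containing[OF n] by (intro sum.cong) (auto simp: Q_def)
    also have "of_nat \<dots> * f v = (\<Sum>g | g \<in> ?D \<and> Q v g. complex_of_real (ideal_norm g) * f v)"
      by (simp add: ideal_norm_def sum_distrib_right)
    also have "\<dots> = (\<Sum>g\<in>?D. if Q v g then complex_of_real (ideal_norm g) * f v else 0)"
      using finD by (rule sum.inter_filter)
    finally show "(\<Sum>M\<in>hecke_matrices n. if P v M then 1 * f v else 0) =
        (\<Sum>g\<in>?D. if Q v g then complex_of_real (ideal_norm g) * f v else 0)" .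
  qed
  also have "\<dots> = (\<Sum>g\<in>?D. \<Sum>\<^sub>\<infinity>v\<in>?V. if Q v g then complex_of_real (ideal_norm g) * f v else 0)"
    by (rule sum_infsum_swap[OF finD summ, symmetric])
  also have "\<dots> = (\<Sum>g\<in>?D. complex_of_real (ideal_norm g) * (\<Sum>\<^sub>\<infinity>(x, y)\<in>?V. f (g * x, g * y)))"
    by (intro sum.cong refl R)
  finally show ?thesis .
qed

section \<open>Convergence of the lattice sums and the Hecke eigenvalue\<close>

context C_infty
begin

lemma nv_A: "nv (\<iota> (A_to_kinf p)) = (if p = 0 then 0 else ideal_norm p)"
  by (simp add: nv_iota kinf_abs_A_to_kinf) (simp add: kinf_abs_def)

definition lform :: "'c \<Rightarrow> 'f poly \<times> 'f poly \<Rightarrow> 'c" where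
  "lform z v = \<iota> (A_to_kinf (fst v)) * z + \<iota> (A_to_kinf (snd v))"

lemma lform_nonzero: "z \<in> Omega \<iota> \<Longrightarrow> v \<noteq> (0, 0) \<Longrightarrow> lform z v \<noteq> 0"
  unfolding lform_def
  by (rule linear_form_nonzero) (use subdegree_A_to_kinf in \<open>auto simp: prod_eq_iff\<close>)

lemma lform_scale: "lform z (m * x, m * y) = \<iota> (A_to_kinf m) * lform z (x, y)"
  by (simp add: lform_def A_to_kinf_mult iota_mult algebra_simps)

text \<open>The value of \<open>x z + y\<close> controls \<open>x\<close> through the positive
  \<open>|z|_i\<close>, and then \<open>y\<close> as the difference of that value and
  \<open>x z\<close>.\<close>

lemma ideal_norm_le_nv_lform:
  assumes i: "imag_abs \<iota> nv z > 0"
  obtains K where "K > 0"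
    "\<And>x y. (x, y) \<noteq> (0, 0) \<Longrightarrow> ideal_norm x \<le> K * nv (lform z (x, y))"
    "\<And>x y. (x, y) \<noteq> (0, 0) \<Longrightarrow> ideal_norm y \<le> K * nv (lform z (x, y))"
proof -
  let ?i = "imag_abs \<iota> nv z" and ?a = "\<lambda>p. nv (\<iota> (A_to_kinf p))"
  \<comment> \<open>One summand for each estimate: of the form itself, of \<open>x z\<close>, and of
    \<open>x\<close>.\<close>
  define K where "K = 1 + nv z / ?i + 1 / ?i"
  have K: "K \<ge> 1" "K \<ge> 1 / ?i" "K \<ge> nv z / ?i" using i by (simp_all add: K_def)
  have ab: "?a x \<le> K * nv (lform z (x, y))" "?a y \<le> K * nv (lform z (x, y))" for x y
  proof -
    let ?L = "nv (lform z (x, y))"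
    have "?a x * ?i \<le> ?L" using imag_abs_mult_le by (simp add: lform_def)
    then have x: "?a x \<le> 1 / ?i * ?L" using i by (simp add: field_simps)
    also have "\<dots> \<le> K * ?L" using K by (intro mult_right_mono) auto
    finally show "?a x \<le> K * ?L" .
    have "\<iota> (A_to_kinf y) = lform z (x, y) - \<iota> (A_to_kinf x) * z" by (simp add: lform_def)
    then have "?a y \<le> max ?L (?a x * nv z)" using nv_diff_le by (metis nv_mult)
    also have "\<dots> \<le> K * ?L"
    proof (rule max.boundedI)
      show "?L \<le> K * ?L" using mult_right_mono[OF K(1), of ?L] by simp
      have "?a x * nv z \<le> nv z / ?i * ?L"
        using mult_right_mono[OF x, of "nv z"] by (simp add: mult.commute)
      also have "\<dots> \<le> K * ?L" using K by (intro mult_right_mono) auto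
      finally show "?a x * nv z \<le> K * ?L" .
    qed
    finally show "?a y \<le> K * ?L" .
  qed
  \<comment> \<open>Since \<open>ideal_norm 0 = 1\<close> while the absolute value of 0 is 0, a zero
    coordinate has to borrow its bound from the nonzero one, whose absolute value is at least
    1.\<close>
  have le: "ideal_norm p \<le> max (?a p) (?a r)" if "p \<noteq> 0 \<or> r \<noteq> 0" for p r :: "'f poly"
    using that ideal_norm_ge_1[of r] by (auto simp: nv_A ideal_norm_def)
  show ?thesis
  proof (rule that[of K])
    fix x y :: "'f poly" assume "(x, y) \<noteq> (0, 0)"
    then have "x \<noteq> 0 \<or> y \<noteq> 0" "y \<noteq> 0 \<or> x \<noteq> 0" by auto
    from this[THEN le] ab(1)[of x y] ab(2)[of y x]
    show "ideal_norm x \<le> K * nv (lform z (x, y))" "ideal_norm y \<le> K * nv (lform z (x, y))"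
      by linarith+
  qed (use K in simp)
qed

definition eis_term :: "complex \<Rightarrow> 'c \<Rightarrow> 'f poly \<times> 'f poly \<Rightarrow> complex" where
  "eis_term s z v = complex_of_real (nv (lform z v)) powr (- (2 * s))"

text \<open>The exponent \<open>2 * Re s\<close> is divided evenly between the two coordinates, each
  bounded by a multiple of the linear form. This gives a majorant that is a product of two
  one-variable series, convergent for \<open>Re s > 1\<close>.\<close>

lemma eis_term_summable:
  assumes z: "z \<in> Omega \<iota>" and i: "imag_abs \<iota> nv z > 0" and s: "Re s > 1"
  shows "eis_term s z summable_on - {(0, 0)}"
proof -
  obtain K where K: "K > 0"
    "\<And>x y. (x, y) \<noteq> (0, 0) \<Longrightarrow> ideal_norm x \<le> K * nv (lform z (x, y))"
    "\<And>x y. (x, y) \<noteq> (0, 0) \<Longrightarrow> ideal_norm y \<le> K * nv (lform z (x, y))"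
    using ideal_norm_le_nv_lform[OF i] by metis
  define h where "h p = (ideal_norm p / K) powr (- Re s)" for p :: "'f poly"
  have h: "h summable_on UNIV"
  proof -
    have "h = (\<lambda>p. ideal_norm p powr (- Re s) * K powr Re s)"
      using K(1) ideal_norm_pos
      by (auto simp: h_def powr_divide powr_minus field_simps less_imp_le)
    then show ?thesis by (simp only: summable_on_cmult_left[OF summable_ideal_norm[OF s]])
  qed
  have "(\<lambda>v. h (fst v) * h (snd v)) summable_on (UNIV \<times> UNIV)"
  proof (rule summable_on_SigmaI)
    show "((\<lambda>y. h (fst (x, y)) * h (snd (x, y))) has_sum h x * infsum h UNIV) UNIV" for x
      using has_sum_cmult_right[OF has_sum_infsum[OF h]] by simp
    show "(\<lambda>x. h x * infsum h UNIV) summable_on UNIV"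
      using h by (rule summable_on_cmult_left)
  qed (auto simp: h_def)
  then have "(\<lambda>v. h (fst v) * h (snd v)) summable_on - {(0, 0)}"
    by (rule summable_on_subset_banach) simp
  moreover have "norm (eis_term s z v) \<le> h (fst v) * h (snd v)" if "v \<in> - {(0, 0)}" for v
  proof -
    obtain x y where v: "v = (x, y)" by (cases v)
    let ?L = "nv (lform z v)"
    have L: "?L > 0" using lform_nonzero[OF z, of v] that by simp
    have "norm (eis_term s z v) = ?L powr (- Re s) * ?L powr (- Re s)"
      using L by (simp add: eis_term_def norm_of_real_powr flip: powr_add)
    also have "\<dots> \<le> h x * h y"
      unfolding h_def using K that L s ideal_norm_pos
      by (intro mult_mono powr_mono2') (auto simp: v field_simps)
    finally show ?thesis by (simp add: v)
  qed
  ultimately have "eis_term s z abs_summable_on - {(0, 0)}"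
    by (rule abs_summable_on_comparison_test')
  then show ?thesis by (rule abs_summable_summable)
qed

lemma imag_abs_mob:
  assumes z: "z \<in> Omega \<iota>" and g: "g \<in> GL2A"
  shows "imag_abs \<iota> nv (mob \<iota> g z) = imag_abs \<iota> nv z / (nv (lform z (snd (snd g))))\<^sup>2"
proof -
  obtain a b c d where abcd: "g = (a, b, c, d)" by (cases g)
  obtain u where u: "u \<noteq> 0" "a * d - b * c = [:u:]" using g by (auto simp: GL2A_def abcd)
  have "A_to_kinf a * A_to_kinf d = A_to_kinf (a * d - b * c) + A_to_kinf b * A_to_kinf c"
    by (simp flip: A_to_kinf_mult A_to_kinf_add)
  then have det: "A_to_kinf a * A_to_kinf d - A_to_kinf b * A_to_kinf c = A_to_kinf [:u:]"
    unfolding u by simp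
  have "nv (\<iota> (A_to_kinf [:u:])) = 1" using u by (simp add: nv_A ideal_norm_def)
  moreover have "A_to_kinf [:u:] \<noteq> 0" using u subdegree_A_to_kinf[of "[:u:]"] by simp
  ultimately show ?thesis
    using imag_abs_moebius[OF z, of "A_to_kinf a" "A_to_kinf d" "A_to_kinf b" "A_to_kinf c"]
    unfolding det by (simp add: abcd mob_def lform_def)
qed

lemma Eis_eq_infsum_coset_row:
  assumes z: "z \<in> Omega \<iota>"
  shows "Eis \<iota> nv z s =
    complex_of_real (imag_abs \<iota> nv z) powr s * (\<Sum>\<^sub>\<infinity>C\<in>cosets_inf. eis_term s z (coset_row C))"
proof -
  have "Eis \<iota> nv z s = (\<Sum>\<^sub>\<infinity>C\<in>cosets_inf.
      complex_of_real (imag_abs \<iota> nv z) powr s * eis_term s z (coset_row C))"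
    unfolding Eis_def coset_rep_def [symmetric]
  proof (rule infsum_cong)
    fix C :: "'f mat2 set" assume C: "C \<in> cosets_inf"
    have "nv (lform z (coset_row C)) > 0"
      using lform_nonzero[OF z coset_row_nonzero[OF C]] by simp
    then show "complex_of_real (imag_abs \<iota> nv (mob \<iota> (coset_rep C) z)) powr s =
        complex_of_real (imag_abs \<iota> nv z) powr s * eis_term s z (coset_row C)"
      unfolding imag_abs_mob[OF z coset_rep_GL2A[OF C]] eis_term_def coset_row_def [symmetric]
      by (intro of_real_powr_div_square) auto
  qed
  then show ?thesis by (simp add: infsum_cmult_right')
qed

text \<open>Writing each nonzero vector uniquely as a multiplier times the row of a coset factors
  the lattice sum into a sum over multipliers and a sum over cosets. If \<open>|z|_i = 0\<close>,
  both sides vanish.\<close>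

lemma zeta_times_Eis:
  assumes z: "z \<in> Omega \<iota>" and s: "Re s > 1"
  shows "zeta_A TYPE('f) (2 * s) * Eis \<iota> nv z s =
    complex_of_real (imag_abs \<iota> nv z) powr s * infsum (eis_term s z) (- {(0, 0)})"
proof (cases "imag_abs \<iota> nv z = 0")
  case True
  then show ?thesis by (simp add: Eis_eq_infsum_coset_row[OF z])
next
  case False
  then have i: "imag_abs \<iota> nv z > 0" using imag_abs_nonneg[of z] by linarith
  let ?g = "\<lambda>m :: 'f poly. complex_of_real (ideal_norm m) powr (- (2 * s))"
  let ?h = "\<lambda>C. eis_term s z (coset_row C)"
  let ?b = "\<lambda>(m, C). (m * fst (coset_row C), m * snd (coset_row C))"
  have mult: "eis_term s z (?b (m, C)) = ?g m * ?h C" if "m \<in> - {0}" for m C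
    using that
    by (simp add: eis_term_def lform_scale nv_mult nv_A powr_times_real ideal_norm_pos less_imp_le)
  have eq: "eis_term s z (?b v) = (\<lambda>(m, C). ?g m * ?h C) v"
    if "v \<in> (- {0}) \<times> cosets_inf" for v
    using that mult[of "fst v" "snd v"] by (simp add: mem_Times_iff case_prod_unfold)
  have summ: "(\<lambda>(m, C). ?g m * ?h C) summable_on ((- {0}) \<times> cosets_inf)"
    using summable_on_reindex_bij_betw[OF bij_betw_coset_row, THEN iffD2, OF eis_term_summable[OF z i s]]
    by (rule summable_on_cong[THEN iffD1, rotated]) (rule eq)
  have "infsum (eis_term s z) (- {(0, 0)}) = infsum (\<lambda>v. eis_term s z (?b v)) ((- {0}) \<times> cosets_inf)"
    by (rule infsum_reindex_bij_betw[OF bij_betw_coset_row, symmetric])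
  also have "\<dots> = infsum (\<lambda>(m, C). ?g m * ?h C) ((- {0}) \<times> cosets_inf)"
    by (rule infsum_cong) (rule eq)
  also have "\<dots> = (\<Sum>\<^sub>\<infinity>m\<in>- {0}. \<Sum>\<^sub>\<infinity>C\<in>cosets_inf. ?g m * ?h C)"
    by (rule infsum_Sigma'_banach[OF summ, symmetric])
  also have "\<dots> = zeta_A TYPE('f) (2 * s) * infsum ?h cosets_inf"
    by (simp add: infsum_cmult_right' infsum_cmult_left' zeta_A_def)
  finally show ?thesis by (simp add: Eis_eq_infsum_coset_row[OF z])
qed

text \<open>For \<open>w = (a z + b) / d\<close> one has \<open>|w|_i = |n| |z|_i / |d|^2\<close>,
  while \<open>x w + y\<close> is the value at \<open>z\<close> of the vector
  \<open>(x a, x b + y d)\<close>, divided by \<open>d\<close>. The two resulting powers of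
  \<open>|d|\<close> cancel, so the factor in front is the same for all matrices.\<close>

lemma zeta_times_Eis_hecke_matrix:
  assumes z: "z \<in> Omega \<iota>" and s: "Re s > 1" and n: "lead_coeff n = 1"
    and H: "(a, b, d) \<in> hecke_matrices n"
  shows "zeta_A TYPE('f) (2 * s) * Eis \<iota> nv (mob \<iota> (a, b, 0, d) z) s =
    complex_of_real (ideal_norm n) powr s * complex_of_real (imag_abs \<iota> nv z) powr s *
      (\<Sum>\<^sub>\<infinity>(x, y)\<in>- {(0, 0)}. eis_term s z (x * a, x * b + y * d))"
proof -
  have n0: "n \<noteq> 0" using n by auto
  then have nz: "a \<noteq> 0" "d \<noteq> 0" and ad: "n = a * d" using H by (auto simp: hecke_matrices_def)
  let ?w = "mob \<iota> (a, b, 0, d) z" and ?N = "\<lambda>p. complex_of_real (ideal_norm p)"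
    and ?i = "complex_of_real (imag_abs \<iota> nv z)"
  have det: "A_to_kinf a * A_to_kinf d - A_to_kinf b * A_to_kinf 0 \<noteq> 0"
    using nz subdegree_A_to_kinf by auto
  have w: "?w \<in> Omega \<iota>" using moebius_in_Omega[OF z det] by (simp add: mob_def)
  have dnz: "\<iota> (A_to_kinf d) \<noteq> 0" using nz subdegree_A_to_kinf by auto
  have "imag_abs \<iota> nv ?w = ideal_norm a * imag_abs \<iota> nv z / ideal_norm d"
    using imag_abs_moebius[OF z det] nz ideal_norm_pos[of d]
    by (simp add: mob_def iota_mult nv_mult nv_A power2_eq_square)
  also have "\<dots> = (ideal_norm n * imag_abs \<iota> nv z) / (ideal_norm d)\<^sup>2"
    using nz ideal_norm_pos[of d] by (simp add: ad ideal_norm_mult power2_eq_square)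
  finally have "complex_of_real (imag_abs \<iota> nv ?w) powr s =
      (?N n * ?i) powr s * ?N d powr (- (2 * s))"
    using of_real_powr_div_square[of "ideal_norm n * imag_abs \<iota> nv z" "ideal_norm d" s]
    by (simp add: ideal_norm_pos less_imp_le)
  also have "(?N n * ?i) powr s = ?N n powr s * ?i powr s"
    by (simp add: powr_times_real ideal_norm_pos less_imp_le)
  finally have iw: "complex_of_real (imag_abs \<iota> nv ?w) powr s =
      ?N n powr s * ?i powr s * ?N d powr (- (2 * s))" .
  have "infsum (eis_term s ?w) (- {(0, 0)}) =
      (\<Sum>\<^sub>\<infinity>(x, y)\<in>- {(0, 0)}. ?N d powr (2 * s) * eis_term s z (x * a, x * b + y * d))"
  proof (rule infsum_cong)
    fix v :: "'f poly \<times> 'f poly"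
    obtain x y where v: "v = (x, y)" by (cases v)
    have "lform ?w (x, y) * \<iota> (A_to_kinf d) = lform z (x * a, x * b + y * d)"
      using dnz by (simp add: lform_def mob_def A_to_kinf_mult A_to_kinf_add iota_simps field_simps)
    then have L: "nv (lform z (x * a, x * b + y * d)) = nv (lform ?w (x, y)) * ideal_norm d"
      using nz by (metis nv_mult nv_A)
    have "?N d powr (2 * s) * ?N d powr (- (2 * s)) = 1"
      using ideal_norm_pos[of d] by (simp flip: powr_add)
    then show "eis_term s ?w v =
        (case v of (x, y) \<Rightarrow> ?N d powr (2 * s) * eis_term s z (x * a, x * b + y * d))"
      by (simp add: v eis_term_def L powr_times_real ideal_norm_pos less_imp_le)
  qed
  also have "\<dots> = ?N d powr (2 * s) * (\<Sum>\<^sub>\<infinity>(x, y)\<in>- {(0, 0)}. eis_term s z (x * a, x * b + y * d))"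
    by (simp add: infsum_cmult_right' case_prod_unfold)
  finally have G: "infsum (eis_term s ?w) (- {(0, 0)}) =
    ?N d powr (2 * s) * (\<Sum>\<^sub>\<infinity>(x, y)\<in>- {(0, 0)}. eis_term s z (x * a, x * b + y * d))" .
  have "?N d powr (- (2 * s)) * ?N d powr (2 * s) = 1"
    using ideal_norm_pos[of d] by (simp flip: powr_add)
  then show ?thesis
    unfolding zeta_times_Eis[OF w s] iw G by simp
qed

text \<open>Both sides are compared after multiplication by \<open>?\<zeta>\<close>, which replaces
  the series over cosets by lattice sums; \<open>?\<zeta>\<close> is nonzero and is cancelled at the
  end.\<close>

lemma hecke_Eis:
  assumes z: "z \<in> Omega \<iota>" and s: "Re s > 1" and n: "lead_coeff n = 1"
  shows "hecke \<iota> n (\<lambda>w. Eis \<iota> nv w s) z =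
    complex_of_real (ideal_norm n) powr s * sigma_div (1 - 2 * s) n * Eis \<iota> nv z s"
proof -
  let ?\<zeta> = "zeta_A TYPE('f) (2 * s)" and ?N = "\<lambda>p. complex_of_real (ideal_norm p)"
    and ?i = "complex_of_real (imag_abs \<iota> nv z)"
  have "?\<zeta> * hecke \<iota> n (\<lambda>w. Eis \<iota> nv w s) z =
      (\<Sum>(a, b, d)\<in>hecke_matrices n. ?\<zeta> * Eis \<iota> nv (mob \<iota> (a, b, 0, d) z) s)"
    unfolding hecke_def hecke_matrices_def [symmetric] by (simp add: sum_distrib_left case_prod_unfold)
  also have "\<dots> = (\<Sum>(a, b, d)\<in>hecke_matrices n. ?N n powr s * ?i powr s *
      (\<Sum>\<^sub>\<infinity>(x, y)\<in>- {(0, 0)}. eis_term s z (x * a, x * b + y * d)))"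
    by (intro sum.cong refl) (clarsimp simp only: zeta_times_Eis_hecke_matrix[OF z s n] split: prod.splits)
  also have "\<dots> = ?N n powr s * (?i powr s * (\<Sum>(a, b, d)\<in>hecke_matrices n.
      \<Sum>\<^sub>\<infinity>(x, y)\<in>- {(0, 0)}. eis_term s z (x * a, x * b + y * d)))"
    by (simp add: sum_distrib_left case_prod_unfold mult.assoc)
  also have "?i powr s * (\<Sum>(a, b, d)\<in>hecke_matrices n.
      \<Sum>\<^sub>\<infinity>(x, y)\<in>- {(0, 0)}. eis_term s z (x * a, x * b + y * d)) =
      ?i powr s * (sigma_div (1 - 2 * s) n * infsum (eis_term s z) (- {(0, 0)}))"
  proof (cases "imag_abs \<iota> nv z = 0")
    case False
    then have i: "imag_abs \<iota> nv z > 0" using imag_abs_nonneg[of z] by linarith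
    \<comment> \<open>Scaling a vector by \<open>g\<close> multiplies its term by \<open>|g|\<close>
      to the power \<open>-2s\<close>; together with the weight \<open>|g|\<close> this is the
      summand of \<open>sigma_div (1 - 2 * s) n\<close>.\<close>
    have "?N g * (\<Sum>\<^sub>\<infinity>(x, y)\<in>- {(0, 0)}. eis_term s z (g * x, g * y)) =
        ?N g powr (1 - 2 * s) * infsum (eis_term s z) (- {(0, 0)})" if "lead_coeff g = 1" for g
    proof -
      have g0: "g \<noteq> 0" using that by auto
      have "(\<Sum>\<^sub>\<infinity>(x, y)\<in>- {(0, 0)}. eis_term s z (g * x, g * y)) =
          (\<Sum>\<^sub>\<infinity>v\<in>- {(0, 0)}. ?N g powr (- (2 * s)) * eis_term s z v)"
        using g0 by (intro infsum_cong)
          (auto simp: eis_term_def lform_scale nv_mult nv_A powr_times_real ideal_norm_pos less_imp_le)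
      also have "\<dots> = ?N g powr (- (2 * s)) * infsum (eis_term s z) (- {(0, 0)})"
        by (rule infsum_cmult_right')
      also have "?N g * \<dots> = ?N g powr (1 + - (2 * s)) * infsum (eis_term s z) (- {(0, 0)})"
        unfolding powr_add using ideal_norm_pos[of g] by simp
      finally show ?thesis by simp
    qed
    then show ?thesis
      unfolding sum_hecke_matrices_infsum[OF n eis_term_summable[OF z i s]]
      by (simp add: sigma_div_def sum_distrib_right)
  qed simp
  also have "?N n powr s * \<dots> = ?N n powr s * sigma_div (1 - 2 * s) n *
      (?i powr s * infsum (eis_term s z) (- {(0, 0)}))" by simp
  also have "\<dots> = ?\<zeta> * (?N n powr s * sigma_div (1 - 2 * s) n * Eis \<iota> nv z s)"
    unfolding zeta_times_Eis[OF z s, symmetric] by simp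
  finally show ?thesis
    using zeta_A_nonzero[of "2 * s", where 'f = 'f] s by simp
qed

end

theorem theorem6p5:
  fixes \<iota> :: "'f::{field,finite} fls \<Rightarrow> 'c::field"
    and nv :: "'c \<Rightarrow> real"
    and n :: "'f poly" and z :: 'c and s :: complex
  assumes "odd CARD('f)"
    and "is_C_infty \<iota> nv"
    and "lead_coeff n = 1"
    and "z \<in> Omega \<iota>"
    and "Re s > 1"
  shows "hecke \<iota> n (\<lambda>w. Eis \<iota> nv w s) z
         = complex_of_real (ideal_norm n) powr s * sigma_div (1 - 2 * s) n * Eis \<iota> nv z s"
proof -
  interpret C_infty \<iota> nv using assms(2) by unfold_locales
  show ?thesis using assms by (intro hecke_Eis)
qed

end
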